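(* Let $p$ be a prime, $r\ge 1$ an integer, and let $G_1(D), G_2(D)\in \mathbb{Z}_{p^r}[D]^{k\times n}$ be two equivalent reduced internal degree matrices (RIDMs). Then $\Delta_p(G_1)=\Delta_p(G_2)$.
   Context: $\mathbb{Z}_{p^r}=\mathbb{Z}/p^r\mathbb{Z}$; $a\mapsto\overline{a}$ denotes reduction modulo $p$ onto $\mathbb{F}_p$, extended coefficientwise to polynomials, Laurent series and matrices. $\mathbb{Z}_{p^r}((D))$ is the ring of formal Laurent series in $D$ (finitely many negative powers of $D$). A free convolutional code $\mathcal{C}$ of length $n$ and rank $k$ over $\mathbb{Z}_{p^r}$ is a free submodule of $\mathbb{Z}_{p^r}((D))^n$ of rank $k$ generated by the rows of a $k\times n$ polynomial matrix $G(D)\in\mathbb{Z}_{p^r}[D]^{k\times n}$ of full rank (rows linearly independent over $\mathbb{Z}_{p^r}((D))$), i.e. $\mathcal{C}=\{\mathbf{u}(D)G(D) : \mathbf{u}(D)\in\mathbb{Z}_{p^r}((D))^k\}$. Such a $G(D)$ is called a generator matrix (or encoder) of $\mathcal{C}$. Two generator matrices in $\mathbb{Z}_{p^r}[D]^{k\times n}$ are equivalent if they generate the same code. The internal degree $\mathrm{intdeg}(G)$ of a generator matrix $G(D)$ is the maximum of the degrees of all $k\times k$ minors of $G(D)$. A generator matrix $G(D)$ is a reduced internal degree matrix (RIDM) if its internal degree is minimal among all polynomial generator matrices equivalent to $G(D)$. For a RIDM $G(D)$, the residual structural polynomial $\Delta_p(G)\in\mathbb{F}_p[D]$ is the (monic)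 greatest common divisor in $\mathbb{F}_p[D]$ of the $k\times k$ minors of the projected matrix $\overline{G}(D)\in\mathbb{F}_p[D]^{k\times n}$. *)

theory Defs
  imports
    "HOL-Computational_Algebra.Computational_Algebra"
    "Berlekamp_Zassenhaus.Finite_Field"
    "Jordan_Normal_Form.Determinant"
    "Jordan_Normal_Form.DL_Submatrix"
begin

text \<open>
  For a type \<open>'q\<close> with \<open>p ^ r\<close> elements, \<open>'q mod_ring\<close> is the ring of integers modulo \<open>p ^ r\<close>;
  for a type \<open>'p\<close> of prime cardinality \<open>p\<close>, \<open>'p mod_ring\<close> is the field with \<open>p\<close> elements.
  The variable of both polynomials and formal Laurent series plays the role of \<open>D\<close>.
\<close>

definition poly_to_fls :: "'a::comm_ring_1 poly \<Rightarrow> 'a fls" where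
  "poly_to_fls f = fps_to_fls (fps_of_poly f)"

text \<open>The row vector \<open>u G\<close> is written as the transpose of \<open>G\<close> applied to the vector \<open>u\<close>.\<close>

definition encode :: "'a::comm_ring_1 poly mat \<Rightarrow> 'a fls vec \<Rightarrow> 'a fls vec" where
  "encode G u = transpose_mat (map_mat poly_to_fls G) *\<^sub>v u"

definition conv_code :: "'a::comm_ring_1 poly mat \<Rightarrow> 'a fls vec set" where
  "conv_code G = encode G ` carrier_vec (dim_row G)"

definition full_rank :: "'a::comm_ring_1 poly mat \<Rightarrow> bool" where
  "full_rank G \<longleftrightarrow>
     (\<forall>u \<in> carrier_vec (dim_row G). encode G u = 0\<^sub>v (dim_col G) \<longrightarrow> u = 0\<^sub>v (dim_row G))"

definition generator_matrix :: "nat \<Rightarrow> nat \<Rightarrow> 'a::comm_ring_1 poly mat \<Rightarrow> bool" where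
  "generator_matrix k n G \<longleftrightarrow> G \<in> carrier_mat k n \<and> full_rank G"

definition equivalent_generators ::
  "nat \<Rightarrow> nat \<Rightarrow> 'a::comm_ring_1 poly mat \<Rightarrow> 'a poly mat \<Rightarrow> bool" where
  "equivalent_generators k n G G' \<longleftrightarrow>
     generator_matrix k n G \<and> generator_matrix k n G' \<and> conv_code G = conv_code G'"

text \<open>The minors of order \<open>dim_row G\<close>: all rows are kept, the columns are those indexed by \<open>J\<close>.\<close>

definition full_minors :: "'a::comm_ring_1 mat \<Rightarrow> 'a set" where
  "full_minors G = {det (submatrix G UNIV J) | J. J \<subseteq> {..<dim_col G} \<and> card J = dim_row G}"

text \<open>
  The library convention \<open>degree 0 = 0\<close> does not affect the maximum: the rows of a generator
  matrix are linearly independent, so at least one of these minors is nonzero (and \<open>k \<le> n\<close>,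
  so the set of minors is nonempty).
\<close>

definition intdeg :: "'a::comm_ring_1 poly mat \<Rightarrow> nat" where
  "intdeg G = Max (degree ` full_minors G)"

definition RIDM :: "nat \<Rightarrow> nat \<Rightarrow> 'a::comm_ring_1 poly mat \<Rightarrow> bool" where
  "RIDM k n G \<longleftrightarrow> generator_matrix k n G \<and>
     (\<forall>G'. equivalent_generators k n G G' \<longrightarrow> intdeg G \<le> intdeg G')"

text \<open>
  Reduction modulo \<open>CARD('p)\<close>, via the representative in \<open>{0..<CARD('q)}\<close>; this is the canonical
  ring homomorphism whenever \<open>CARD('p)\<close> divides \<open>CARD('q)\<close>.
\<close>

definition reduce_mod :: "'q::finite mod_ring \<Rightarrow> 'p::finite mod_ring" where
  "reduce_mod a = of_int_mod_ring (to_int_mod_ring a)"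

definition reduce_mat :: "'q::finite mod_ring poly mat \<Rightarrow> 'p::finite mod_ring poly mat" where
  "reduce_mat G = map_mat (map_poly reduce_mod) G"

text \<open>\<open>Gcd\<close> of polynomials over a field is normalized, i.e. monic unless it is zero.\<close>

definition residual_structural_poly ::
  "'q::nontriv mod_ring poly mat \<Rightarrow> 'p::prime_card mod_ring poly" where
  "residual_structural_poly G = Gcd (full_minors (reduce_mat G))"

end

(* Write G2 = U G1 with U invertible over the Laurent series; the full minors of G2 are then
   u = det U times those of G1. Reducing modulo the prime, u becomes (unit) * Delta(G2) / Delta(G1).
   Suppose this fraction has a nontrivial reduced denominator, and let f be a monic lift of it.
   Let A = R[D][1/f] and let B be the ring of fractions whose denominators are coprime to f modulo the
   prime. Then u = w v with v a unit of B and w a unit of A that is a quotient of monic polynomials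
   of negative degree - deg f. Since A is dense in the ring of all fractions for the f-adic topology
   of B, and U is up to a diagonal factor a product of transvections, U also factors as a
   B-invertible matrix times an A-invertible matrix T with det T = w (strong approximation). Now T G1
   has entries in the intersection of A and B, that is, polynomial entries, it encodes the same code,
   and its minors have degree smaller by deg f than those of G1, contradicting minimality.
   Hence Delta(G1) divides Delta(G2), and the converse holds by symmetry. *)

theory Submission
  imports
    Defs
    "Jordan_Normal_Form.Char_Poly"
    "Jordan_Normal_Form.Gauss_Jordan_Elimination"
begin

text \<open>The obstacle is that R[D], with R the integers modulo p^r, has zero divisors, so degrees
  need not add under multiplication and a factor \<open>w\<close> of negative degree does not by
  itself lower the degrees of minors. Multiplication by a monic polynomial does add degrees exactly;
  this is why \<open>f\<close> is lifted to a monic polynomial and why \<open>w\<close> must be a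
  quotient of monic ones. To get it, note that f u agrees modulo the prime with some h coprime to f,
  so f u = h (1 + pi z) with pi the class of p; the factor 1 + pi z is split by partial fractions
  with a proper A-part, one power of pi after another. A splitting of the determinant alone gives no
  encoder: T needs determinant w while T G1 stays polynomial. Since T = W U with W over B, the
  matrix T G1 = W G2 is over A by its first form and over B by its second. Full rank enters twice:
  it gives a full minor of G1 with nonzero reduction, hence invertible among Laurent series. By
  Cramer's rule this puts U over the ring of all fractions, and it makes the quotient defining u
  meaningful after reduction.\<close>

hide_const (open) UnivPoly.coeff UnivPoly.monom Module.smult

section \<open>Residue maps with nilpotent principal kernel\<close>

interpretation poly_to_fls: inj_comm_ring_hom "poly_to_fls :: 'a::comm_ring_1 poly \<Rightarrow> 'a fls"
  by unfold_locales
    (auto simp: poly_to_fls_def fps_of_poly_add fps_of_poly_mult fls_times_fps_to_fls fps_of_poly_eq_iff)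

text \<open>The product \<open>(x + c) * y\<close> is \<open>1 - d\<close> with \<open>d\<close>
  nilpotent, and the finite geometric series inverts it.\<close>

lemma unit_add_nilpotent:
  fixes x :: "'a::comm_ring_1"
  assumes "x * y = 1" and "c ^ N = 0"
  shows "\<exists>z. (x + c) * z = 1"
proof -
  define d where "d = - (c * y)"
  have "d ^ N = 0" using assms(2) by (simp add: d_def power_minus' power_mult_distrib) 
  then have "(1 - d) * (\<Sum>i<N. d ^ i) = 1"
    using one_diff_power_eq[of d N] by simp
  moreover have "(x + c) * y = 1 - d"
    using assms(1) by (simp add: d_def algebra_simps)
  ultimately have "(x + c) * (y * (\<Sum>i<N. d ^ i)) = 1" by (simp add: mult.assoc[symmetric])
  then show ?thesis ..
qed

text \<open>The model is reduction from the integers modulo p^r to the field with p elements, with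
  \<open>\<pi>\<close> the class of p and \<open>e = r - 1\<close>. The exact exponent matters:
  multiplication by \<open>\<pi> ^ e\<close> kills the elements of residue 0 and no others, which
  turns statements about residues into equations over the ring.\<close>

locale residue_map = comm_ring_hom \<rho> for \<rho> :: "'a::comm_ring_1 \<Rightarrow> 'k::field_gcd" +
  fixes \<pi> :: 'a and e :: nat
  assumes surj_\<rho>: "surj \<rho>"
    and ker_\<rho>: "\<rho> a = 0 \<longleftrightarrow> \<pi> dvd a"
    and pi_power_neq_0: "\<pi> ^ e \<noteq> 0"
    and pi_power_eq_0: "\<pi> ^ Suc e = 0"
begin

sublocale red: map_poly_comm_ring_hom \<rho> ..

abbreviation "red \<equiv> map_poly \<rho>"
text \<open>An inverse in the residue field lifts to an inverse up to a nilpotent error.\<close>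

lemma unit_iff: "\<rho> a \<noteq> 0 \<Longrightarrow> \<exists>b. a * b = 1"
proof -
  assume "\<rho> a \<noteq> 0"
  obtain b where b: "\<rho> b = inverse (\<rho> a)" using surj_\<rho> by (metis surjD)
  then have "\<rho> (1 - a * b) = 0" using \<open>\<rho> a \<noteq> 0\<close> by (simp add: hom_distribs)
  then obtain c where c: "1 - a * b = \<pi> * c" using ker_\<rho> by (auto elim: dvdE)
  have "(\<pi> * - c) ^ Suc e = 0" by (simp only: power_mult_distrib pi_power_eq_0 mult_zero_left)
  from unit_add_nilpotent[of 1 1, OF _ this] obtain z where "(1 - \<pi> * c) * z = 1" by auto
  then have "a * (b * z) = 1" using c by (metis diff_diff_eq2 add_diff_cancel_left' mult.assoc diff_add_cancel)
  then show ?thesis ..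
qed

lemma lift_poly:
  obtains g where "red g = h" and "degree g = degree h" and "monic h \<Longrightarrow> monic g"
proof -
  \<comment> \<open>A set-theoretic section of \<open>\<rho>\<close>: fixing 0 preserves degrees,
    fixing 1 preserves monic polynomials.\<close>
  define \<sigma> where "\<sigma> x = (if x = 0 then 0 else if x = 1 then 1 else (SOME a. \<rho> a = x))" for x
  have \<sigma>: "\<rho> (\<sigma> x) = x" for x
    using surj_\<rho> by (auto simp: \<sigma>_def intro!: someI_ex[of "\<lambda>a. \<rho> a = x"]) (metis surjD)
  have [simp]: "\<sigma> 0 = 0" "\<sigma> 1 = 1" by (auto simp: \<sigma>_def)
  have ne: "\<sigma> x \<noteq> 0" if "x \<noteq> 0" for x using \<sigma>[of x] that by auto
  have "red (map_poly \<sigma> h) = h"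
    by (intro poly_eqI) (simp add: coeff_map_poly \<sigma>)
  moreover have "degree (map_poly \<sigma> h) = degree h"
    by (rule degree_map_poly) (metis ne leading_coeff_0_iff \<open>\<sigma> 0 = 0\<close>)
  ultimately show ?thesis by (intro that[of "map_poly \<sigma> h"]) (auto simp: coeff_map_poly)
qed

lemma red_eq_0_iff: "red s = 0 \<longleftrightarrow> [:\<pi>:] dvd s"
proof
  assume "red s = 0"
  then have "\<pi> dvd coeff s i" for i
    by (metis coeff_map_poly hom_zero coeff_0 ker_\<rho>)
  then obtain \<delta> where \<delta>: "coeff s i = \<pi> * \<delta> i" for i by (auto simp: dvd_def) metis
  define t where "t = (\<Sum>i\<le>degree s. monom (\<delta> i) i)"
  have "s = [:\<pi>:] * t"
    by (subst poly_as_sum_of_monoms[symmetric])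
      (simp add: t_def \<delta> smult_monom smult_sum2)
  then show "[:\<pi>:] dvd s" by (rule dvdI)
next
  assume "[:\<pi>:] dvd s"
  then obtain t where "s = [:\<pi>:] * t" ..
  then show "red s = 0" by (intro poly_eqI) (simp add: coeff_map_poly ker_\<rho>)
qed

lemma pi_const_power: "[:\<pi>:] ^ i = [:\<pi> ^ i:]"
  by (induction i) auto

lemma nilpotent_pi: "([:\<pi>:] * c) ^ Suc e = 0"
  by (simp only: power_mult_distrib pi_const_power pi_power_eq_0) simp

text \<open>Up to a nilpotent multiple of \<open>\<pi>\<close>, \<open>s\<close> is a power of D
  times a polynomial whose constant term is a unit; both factors are invertible Laurent
  series.\<close>

lemma regular_unit:
  assumes "red s \<noteq> 0"
  shows "\<exists>y. poly_to_fls s * y = 1"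
proof -
  \<comment> \<open>The order is taken after reduction: \<open>s\<close> may have nonzero
    coefficients below \<open>m\<close>, but \<open>\<pi>\<close> divides them and they go into the
    nilpotent part.\<close>
  define m where "m = (LEAST m. coeff (red s) m \<noteq> 0)"
  have m: "coeff (red s) m \<noteq> 0" 
    unfolding m_def by (rule LeastI_ex) (use assms in \<open>auto simp: poly_eq_iff\<close>)
  have below: "coeff (red s) i = 0" if "i < m" for i
    using not_less_Least[of i "\<lambda>m. coeff (red s) m \<noteq> 0"] that by (auto simp: m_def)
  define g where "g = poly_shift m s"
  have "red (s - monom 1 m * g) = 0"
  proof (rule poly_eqI)
    fix i
    show "coeff (red (s - monom 1 m * g)) i = coeff 0 i"
      using below[of i] by (cases "i < m") (auto simp: coeff_map_poly g_def coeff_monom_mult coeff_poly_shift hom_distribs)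
  qed
  then obtain c where c: "s - monom 1 m * g = [:\<pi>:] * c"
    unfolding red_eq_0_iff by (elim dvdE)
  have "\<rho> (coeff g 0) \<noteq> 0" using m by (simp add: g_def coeff_poly_shift coeff_map_poly)
  then obtain b where b: "coeff g 0 * b = 1" using unit_iff by blast
  have 1: "fps_of_poly g * fps_right_inverse (fps_of_poly g) b = 1"
    by (rule fps_right_inverse) (simp add: b)
  have 2: "poly_to_fls (monom 1 m) * fls_shift (int m) 1 = (1 :: 'a fls)"
    by (simp add: poly_to_fls_def fps_of_poly_monom fls_X_power_conv_shift_1 fps_to_fls_power
       fls_shifted_times_simps)
  have "(poly_to_fls (monom 1 m) * poly_to_fls g) *
      (fls_shift (int m) 1 * fps_to_fls (fps_right_inverse (fps_of_poly g) b)) =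
     (poly_to_fls (monom 1 m) * fls_shift (int m) 1) * (poly_to_fls g * fps_to_fls (fps_right_inverse (fps_of_poly g) b))"
    by (simp only: ac_simps)
  also have "\<dots> = 1" unfolding 2 by (simp add: poly_to_fls_def fls_times_fps_to_fls[symmetric] 1)
  finally have 3: "poly_to_fls (monom 1 m * g) * (fls_shift (int m) 1 * fps_to_fls (fps_right_inverse (fps_of_poly g) b)) = 1"
    by (simp add: hom_distribs)
  have "poly_to_fls ([:\<pi>:] * c) ^ Suc e = 0"
    by (simp only: poly_to_fls.hom_power[symmetric] nilpotent_pi poly_to_fls.hom_zero)
  from unit_add_nilpotent[OF 3 this] show ?thesis
    unfolding c[symmetric] poly_to_fls.hom_add[symmetric] by simp
qed

lemma pi_power_regular:
  assumes "red s \<noteq> 0"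
  shows "[:\<pi>:] ^ e * s \<noteq> 0"
proof
  assume "[:\<pi>:] ^ e * s = 0"
  then have "poly_to_fls ([:\<pi>:] ^ e) * poly_to_fls s = 0" by (simp flip: poly_to_fls.hom_mult)
  moreover obtain y where "poly_to_fls s * y = 1" using regular_unit assms by blast
  ultimately have "poly_to_fls ([:\<pi>:] ^ e) = 0" by (metis mult.assoc mult_zero_left mult.right_neutral)
  then show False using pi_power_neq_0 by (simp add: pi_const_power)
qed

text \<open>Bezout's identity over the residue field lifts to one whose right-hand side is 1 plus a
  nilpotent, which is a unit.\<close>

lemma comaximal:
  assumes "coprime (red s) (red t)"
  shows "\<exists>a b. a * s + b * t = 1"
proof -
  obtain a0 b0 where ab: "a0 * red s + b0 * red t = 1"
    using assms bezout_coefficients_fst_snd[of "red s" "red t"] by (metis coprime_iff_gcd_eq_1)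
  obtain a b where "red a = a0" "red b = b0" using lift_poly by metis
  with ab have "red (a * s + b * t - 1) = 0" by (simp add: hom_distribs)
  then obtain c where c: "a * s + b * t - 1 = [:\<pi>:] * c" unfolding red_eq_0_iff by (elim dvdE)
  obtain z where "(1 + [:\<pi>:] * c) * z = 1"
    using unit_add_nilpotent[OF mult_1_left nilpotent_pi] by blast
  then have "(a * s + b * t) * z = 1" using c by (metis add_diff_cancel_left' diff_add_cancel add.commute)
  then have "(a * z) * s + (b * z) * t = 1" by (simp add: algebra_simps)
  then show ?thesis by blast
qed

end

section \<open>Subrings of Laurent series given by denominators\<close>

text \<open>Subrings are subsets of one type, so that matrices over different rings of fractions can
  be multiplied without embeddings.\<close>

locale subring_set =
  fixes B :: "'a::comm_ring_1 set"
  assumes one_closed: "1 \<in> B"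
    and diff_closed: "x \<in> B \<Longrightarrow> y \<in> B \<Longrightarrow> x - y \<in> B"
    and mult_closed: "x \<in> B \<Longrightarrow> y \<in> B \<Longrightarrow> x * y \<in> B"
begin

lemma zero_closed: "0 \<in> B"
  using diff_closed[OF one_closed one_closed] by simp

lemma uminus_closed: "x \<in> B \<Longrightarrow> - x \<in> B"
  using diff_closed[OF zero_closed] by fastforce

lemma add_closed: "x \<in> B \<Longrightarrow> y \<in> B \<Longrightarrow> x + y \<in> B"
  using diff_closed[OF _ uminus_closed] by fastforce

lemma sum_closed: "(\<And>i. i \<in> I \<Longrightarrow> g i \<in> B) \<Longrightarrow> sum g I \<in> B"
  by (induction I rule: infinite_finite_induct) (auto intro: zero_closed add_closed)

lemma prod_closed: "(\<And>i. i \<in> I \<Longrightarrow> g i \<in> B) \<Longrightarrow> prod g I \<in> B"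
  by (induction I rule: infinite_finite_induct) (auto intro: one_closed mult_closed)

lemma power_closed: "x \<in> B \<Longrightarrow> x ^ i \<in> B"
  by (induction i) (auto intro: one_closed mult_closed)

definition mats :: "nat \<Rightarrow> nat \<Rightarrow> 'a mat set" where
  "mats k n = {M \<in> carrier_mat k n. \<forall>i<k. \<forall>j<n. M $$ (i, j) \<in> B}"

lemma matsI: "M \<in> carrier_mat k n \<Longrightarrow> (\<And>i j. i < k \<Longrightarrow> j < n \<Longrightarrow> M $$ (i, j) \<in> B) \<Longrightarrow> M \<in> mats k n"
  by (simp add: mats_def)

lemma mats_carrier: "M \<in> mats k n \<Longrightarrow> M \<in> carrier_mat k n"
  by (simp add: mats_def)

lemma mats_entry: "M \<in> mats k n \<Longrightarrow> i < k \<Longrightarrow> j < n \<Longrightarrow> M $$ (i, j) \<in> B"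
  by (simp add: mats_def)

lemma mats_mult: "M \<in> mats k l \<Longrightarrow> N \<in> mats l n \<Longrightarrow> M * N \<in> mats k n"
  by (auto simp: mats_def scalar_prod_def intro!: sum_closed mult_closed)

lemma mats_one: "1\<^sub>m k \<in> mats k k"
  by (auto simp: mats_def intro: zero_closed one_closed)

lemma mats_smult: "x \<in> B \<Longrightarrow> M \<in> mats k n \<Longrightarrow> x \<cdot>\<^sub>m M \<in> mats k n"
  by (auto simp: mats_def intro!: mult_closed)

lemma mats_add: "M \<in> mats k n \<Longrightarrow> N \<in> mats k n \<Longrightarrow> M + N \<in> mats k n"
  by (auto simp: mats_def intro!: add_closed)

lemma mats_uminus: "M \<in> mats k n \<Longrightarrow> - M \<in> mats k n"
  by (auto simp: mats_def intro!: uminus_closed)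

lemma det_closed: "M \<in> mats k k \<Longrightarrow> det M \<in> B"
  unfolding mats_def
  by (auto simp: det_def' sign_def permutes_in_image atLeast0LessThan
      intro!: sum_closed mult_closed prod_closed one_closed uminus_closed)

text \<open>The inverse is a polynomial in \<open>c\<close>, so it does not leave
  \<open>B\<close>.\<close>

lemma one_plus_nilpotent_closed:
  assumes c: "c \<in> B" and "c ^ N = 0"
  shows "\<exists>z\<in>B. (1 + c) * z = 1"
proof
  have "(- c) ^ N = 0" using assms(2) by (simp add: power_minus')
  then show "(1 + c) * (\<Sum>i<N. (- c) ^ i) = 1"
    using one_diff_power_eq[of "- c" N] by simp
  show "(\<Sum>i<N. (- c) ^ i) \<in> B"
    by (intro sum_closed power_closed uminus_closed c)
qed

end

text \<open>Fractions are described by the equation they satisfy. All denominators used below have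
  nonzero reduction, hence are units among the Laurent series, so this is the localization realized
  inside that ring.\<close>

definition loc :: "'a::comm_ring_1 poly set \<Rightarrow> 'a fls set" where
  "loc S = {x. \<exists>s\<in>S. \<exists>t. poly_to_fls s * x = poly_to_fls t}"

lemma locI: "s \<in> S \<Longrightarrow> poly_to_fls s * x = poly_to_fls t \<Longrightarrow> x \<in> loc S"
  by (auto simp: loc_def)

lemma loc_mono: "S \<subseteq> S' \<Longrightarrow> loc S \<subseteq> loc S'"
  by (auto simp: loc_def)

lemma subring_set_loc:
  assumes 1: "1 \<in> S" and m: "\<And>s s'. s \<in> S \<Longrightarrow> s' \<in> S \<Longrightarrow> s * s' \<in> S"
  shows "subring_set (loc S)"
proof
  show "1 \<in> loc S" by (rule locI[OF 1, of _ 1]) simp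
next
  fix x y :: "'a fls" assume "x \<in> loc S" "y \<in> loc S"
  then obtain s t s' t' where s: "s \<in> S" "s' \<in> S" and x: "poly_to_fls s * x = poly_to_fls t"
    and y: "poly_to_fls s' * y = poly_to_fls t'"
    by (auto simp: loc_def)
  have "poly_to_fls (s * s') * (x - y) = 
      poly_to_fls s' * (poly_to_fls s * x) - poly_to_fls s * (poly_to_fls s' * y)"
    by (simp add: poly_to_fls.hom_mult algebra_simps)
  also have "\<dots> = poly_to_fls (s' * t - s * t')" by (simp add: x y hom_distribs)
  finally show "x - y \<in> loc S" by (rule locI[OF m[OF s]])
  have "poly_to_fls (s * s') * (x * y) = (poly_to_fls s * x) * (poly_to_fls s' * y)"
    by (simp add: poly_to_fls.hom_mult algebra_simps)
  also have "\<dots> = poly_to_fls (t * t')" by (simp add: x y hom_distribs)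
  finally show "x * y \<in> loc S" by (rule locI[OF m[OF s]])
qed

lemma poly_in_loc: "1 \<in> S \<Longrightarrow> poly_to_fls t \<in> loc S"
  by (rule locI[of 1]) auto

lemma inverse_in_loc: "s \<in> S \<Longrightarrow> poly_to_fls s * x = 1 \<Longrightarrow> x \<in> loc S"
  by (rule locI[of _ _ _ 1]) auto

context residue_map
begin

text \<open>Each common factor \<open>g\<close> of \<open>s\<close> and \<open>f\<close> is
  completed to \<open>f\<close> by its cofactor \<open>f1\<close>, while the degree of
  \<open>s\<close> drops. In this way \<open>f\<close> may be reducible.\<close>

lemma split_off_power:
  fixes f s :: "'k poly"
  assumes "f \<noteq> 0" and "s \<noteq> 0"
  shows "\<exists>N y s'. s * y = f ^ N * s' \<and> coprime s' f"
  using assms(2)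
proof (induction "degree s" arbitrary: s rule: less_induct)
  case less
  show ?case
  proof (cases "coprime s f")
    case True
    then show ?thesis by (intro exI[of _ 0] exI[of _ 1] exI[of _ s]) auto
  next
    case False
    define g where "g = gcd s f"
    have g: "g \<noteq> 0" "\<not> is_unit g"
      using False less.prems is_unit_gcd_iff[of s f] unfolding g_def coprime_iff_gcd_eq_1 by simp_all
    obtain s1 where s1: "s = g * s1" unfolding g_def by (meson dvdE gcd_dvd1)
    obtain f1 where f1: "f = g * f1" unfolding g_def by (meson dvdE gcd_dvd2)
    have "s1 \<noteq> 0" using s1 less.prems by auto
    have "degree g \<noteq> 0" using g is_unit_iff_degree[OF g(1)] by simp
    then have "degree s1 < degree s"
      using \<open>s1 \<noteq> 0\<close> \<open>g \<noteq> 0\<close> by (simp add: s1 degree_mult_eq)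
    from less.hyps[OF this \<open>s1 \<noteq> 0\<close>] obtain N y s' where
      "s1 * y = f ^ N * s'" "coprime s' f" by blast
    then have "s * (y * f1) = f ^ Suc N * s'" by (simp add: s1 f1 algebra_simps)
    then show ?thesis using \<open>coprime s' f\<close> by blast
  qed
qed

end

section \<open>Splitting fractions along a polynomial\<close>

lemma unit_cancel:
  fixes u :: "'a::comm_monoid_mult"
  assumes "u * v = 1" and "u * z = c"
  shows "z = v * c"
  using assms by (metis mult.assoc mult.commute mult_1)

lemma unit_mult:
  fixes u :: "'a::comm_monoid_mult"
  assumes "u * v = 1" and "x * y = 1"
  shows "(u * x) * (v * y) = 1"
proof -
  have "(u * x) * (v * y) = (u * v) * (x * y)" by (simp only: ac_simps)
  then show ?thesis by (simp add: assms)
qed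

lemma monic_times:
  fixes f g :: "'a::comm_semiring_1 poly"
  assumes "monic f" "monic g"
  shows "monic (f * g)"
proof (cases "g = 0")
  case False
  then show ?thesis using assms coeff_mult_degree_sum[of f g] by (simp add: degree_monic_mult)
qed (use assms in simp)

lemma degree_monic_power:
  fixes f :: "'a::comm_ring_1 poly"
  assumes "monic f"
  shows "monic (f ^ N)" "degree (f ^ N) = N * degree f"
proof -
  show m: "monic (f ^ N)" for N by (induction N) (auto intro: monic_times assms)
  then have ne: "f ^ N \<noteq> 0" for N by (metis coeff_0 zero_neq_one)
  show "degree (f ^ N) = N * degree f"
    by (induction N) (simp_all add: degree_monic_mult[OF assms ne])
qed

lemma monic_division:
  fixes f g :: "'a::comm_ring_1 poly"
  assumes "monic g"
  obtains q r where "f = g * q + r" "r = 0 \<or> degree r < degree g"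
proof -
  have "g \<noteq> 0" using assms by auto
  obtain q r where "pseudo_divmod f g = (q, r)" by fastforce
  from pseudo_divmod[OF \<open>g \<noteq> 0\<close> this] assms show ?thesis
    by (intro that[of q r]) auto
qed

locale residue_split = residue_map \<rho> \<pi> e for \<rho> :: "'a::comm_ring_1 \<Rightarrow> 'k::field_gcd" and \<pi> e +
  fixes f :: "'a poly"
  assumes monic_f: "monic f" and degree_f: "degree f > 0"
begin

definition AA where "AA = loc (range (\<lambda>K. f ^ K))"
definition BB where "BB = loc {s. coprime (red s) (red f)}"
text \<open>The total ring of fractions: a polynomial of nonzero reduction is a unit among Laurent
  series, and one of reduction 0 is killed by \<open>\<pi> ^ e\<close>.\<close>

definition QQ where "QQ = loc {s. red s \<noteq> 0}"

lemma monic_red: "monic s \<Longrightarrow> degree (red s) = degree s \<and> red s \<noteq> 0"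
  by (metis coeff_map_poly degree_map_poly hom_one hom_zero one_neq_zero coeff_0)

lemma red_f: "red f \<noteq> 0" "\<not> is_unit (red f)"
  using monic_red[OF monic_f] degree_f is_unit_iff_degree by auto

lemma coprime_regular: "coprime (red s) (red f) \<Longrightarrow> red s \<noteq> 0"
  using red_f by auto

sublocale A: subring_set AA
  unfolding AA_def
  by (rule subring_set_loc) (auto simp flip: power_add intro: range_eqI[of _ _ 0])

sublocale B: subring_set BB
  unfolding BB_def by (rule subring_set_loc) (auto simp: hom_distribs)

sublocale Q: subring_set QQ
  unfolding QQ_def by (rule subring_set_loc) (auto simp: hom_distribs)

lemma poly_in_AA: "poly_to_fls t \<in> AA"
  unfolding AA_def by (rule poly_in_loc) (auto intro: range_eqI[of _ _ 0])

lemma poly_in_BB: "poly_to_fls t \<in> BB"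
  unfolding BB_def by (rule poly_in_loc) auto

lemma poly_in_QQ: "poly_to_fls t \<in> QQ"
  unfolding QQ_def by (rule poly_in_loc) auto

lemma AA_subset: "AA \<subseteq> QQ"
  unfolding AA_def QQ_def by (rule loc_mono) (auto simp: red_f hom_distribs)

lemma BB_subset: "BB \<subseteq> QQ"
  unfolding BB_def QQ_def by (rule loc_mono) (use coprime_regular in auto)

text \<open>The two denominators \<open>f ^ K\<close> and \<open>s\<close> of \<open>x\<close> are
  comaximal, so \<open>x\<close> is a combination of the polynomials \<open>f ^ K * x\<close> and
  \<open>s * x\<close>.\<close>

lemma AA_Int_BB:
  assumes "x \<in> AA" "x \<in> BB"
  shows "\<exists>t. x = poly_to_fls t"
proof -
  obtain K t where t: "poly_to_fls (f ^ K) * x = poly_to_fls t"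
    using assms(1) by (auto simp: AA_def loc_def)
  obtain s u where s: "coprime (red s) (red f)" and u: "poly_to_fls s * x = poly_to_fls u"
    using assms(2) by (auto simp: BB_def loc_def)
  have "coprime (red s) (red (f ^ K))" using s by (simp add: hom_distribs)
  from comaximal[OF this] obtain a b where "a * s + b * f ^ K = 1" by blast
  then have "x = poly_to_fls (a * s + b * f ^ K) * x" by simp
  also have "\<dots> = poly_to_fls a * (poly_to_fls s * x) + poly_to_fls b * (poly_to_fls (f ^ K) * x)"
    by (simp add: poly_to_fls.hom_add poly_to_fls.hom_mult algebra_simps)
  also have "\<dots> = poly_to_fls (a * u + b * t)"
    unfolding t u by (simp add: hom_distribs)
  finally show ?thesis by blast
qed

text \<open>The factorization over the residue field lifts to \<open>s * y1 = X - Y\<close> with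
  \<open>Y\<close> nilpotent. Since \<open>X - Y\<close> divides
  \<open>X ^ Suc e - Y ^ Suc e = X ^ Suc e\<close>, the error disappears at the price of higher
  powers.\<close>

lemma split_denominator:
  assumes "red s \<noteq> 0"
  shows "\<exists>N y s'. s * y = f ^ N * s' \<and> coprime (red s') (red f)"
proof -
  obtain N y0 s0 where 0: "red s * y0 = red f ^ N * s0" "coprime s0 (red f)"
    using split_off_power[OF red_f(1) assms] by blast
  obtain y1 s1 where 1: "red y1 = y0" "red s1 = s0" using lift_poly by metis
  from 0 1 have "red (s * y1 - f ^ N * s1) = 0" by (simp add: hom_distribs)
  then obtain c where c: "s * y1 - f ^ N * s1 = [:\<pi>:] * c" unfolding red_eq_0_iff by (elim dvdE)
  define X where "X = f ^ N * s1"
  define Y where "Y = [:\<pi>:] * (- c)"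
  have "Y ^ Suc e = 0" unfolding Y_def by (rule nilpotent_pi)
  have "s * y1 = X - Y" using c by (simp add: X_def Y_def algebra_simps)
  moreover have "X ^ Suc e - Y ^ Suc e = (X - Y) * (\<Sum>p<Suc e. X ^ p * Y ^ (e - p))"
    by (rule diff_power_eq_sum)
  ultimately have "s * (y1 * (\<Sum>p<Suc e. X ^ p * Y ^ (e - p))) = X ^ Suc e"
    using \<open>Y ^ Suc e = 0\<close> by (simp only: mult.assoc[symmetric] diff_0_right)
  also have "\<dots> = f ^ (N * Suc e) * s1 ^ Suc e"
    unfolding X_def by (simp only: power_mult_distrib power_mult)
  finally have 2: "s * (y1 * (\<Sum>p<Suc e. X ^ p * Y ^ (e - p))) = f ^ (N * Suc e) * s1 ^ Suc e" .
  have "coprime (red (s1 ^ Suc e)) (red f)" 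
    unfolding red.hom_power using 0 1 by (cases "Suc e = 0") (simp_all del: power_Suc)
  with 2 show ?thesis by (intro exI conjI)
qed

text \<open>Partial fractions: modulo \<open>f ^ K\<close> over \<open>BB\<close>, every fraction
  agrees with an element of \<open>AA\<close>. This is the density used for matrices.\<close>

lemma QQ_decompose:
  assumes "x \<in> QQ"
  shows "\<exists>a\<in>AA. \<exists>b\<in>BB. x = a + poly_to_fls (f ^ K) * b"
proof -
  obtain s t where s: "red s \<noteq> 0" and t: "poly_to_fls s * x = poly_to_fls t"
    using assms by (auto simp: QQ_def loc_def)
  obtain N y s' where y: "s * y = f ^ N * s'" and s': "coprime (red s') (red f)"
    using split_denominator[OF s] by blast
  \<comment> \<open>Of the \<open>N + K\<close> factors \<open>f\<close>, \<open>N\<close> cancel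
    the denominator and \<open>K\<close> remain as the accuracy.\<close>
  have "coprime (red s') (red (f ^ (N + K)))" using s' by (simp add: hom_distribs)
  from comaximal[OF this] obtain a b where ab: "a * s' + b * f ^ (N + K) = 1" by blast
  obtain F where F: "poly_to_fls (f ^ N) * F = 1"
    using regular_unit[of "f ^ N"] red_f by (auto simp: hom_distribs)
  obtain S where S: "poly_to_fls s' * S = 1"
    using regular_unit[OF coprime_regular[OF s']] by blast
  have "poly_to_fls (f ^ N) * (poly_to_fls s' * x) = poly_to_fls y * (poly_to_fls s * x)"
    using arg_cong[OF y, of poly_to_fls] unfolding poly_to_fls.hom_mult by (metis mult.assoc mult.commute)
  also have "\<dots> = poly_to_fls (y * t)" by (simp add: t hom_distribs)
  finally have x: "poly_to_fls (f ^ N) * (poly_to_fls s' * x) = poly_to_fls (y * t)" .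
  have xF: "poly_to_fls s' * x = F * poly_to_fls (y * t)"
    by (rule unit_cancel[OF F x])
  have xS: "poly_to_fls (f ^ N) * x = S * poly_to_fls (y * t)"
    by (rule unit_cancel[OF S]) (use x in \<open>simp only: ac_simps\<close>)
  have "x = poly_to_fls (a * s' + b * f ^ (N + K)) * x" by (simp add: ab)
  also have "\<dots> = poly_to_fls a * (poly_to_fls s' * x) + poly_to_fls (f ^ K) * (poly_to_fls b * (poly_to_fls (f ^ N) * x))"
    by (simp add: poly_to_fls.hom_add poly_to_fls.hom_mult power_add algebra_simps)
  finally have "x = poly_to_fls a * (F * poly_to_fls (y * t)) + 
      poly_to_fls (f ^ K) * (poly_to_fls b * (S * poly_to_fls (y * t)))"
    unfolding xF xS .
  moreover have "F \<in> AA" unfolding AA_def by (rule inverse_in_loc[OF _ F]) simp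
  moreover have "S \<in> BB" unfolding BB_def by (rule inverse_in_loc[OF _ S]) (simp add: s')
  ultimately show ?thesis
    by (intro bexI) (assumption | intro A.mult_closed B.mult_closed poly_in_AA poly_in_BB)+
qed

text \<open>Division by the monic \<open>f ^ N\<close> moves the polynomial part of \<open>a\<close>
  into \<open>b\<close>. With \<open>a\<close> a proper fraction, \<open>1 + \<pi>\<^sup>j a\<close>
  becomes a quotient of monic polynomials of equal degree.\<close>

lemma QQ_decompose_proper:
  assumes "x \<in> QQ"
  obtains a b N t where "a \<in> AA" "b \<in> BB" "x = a + b" "poly_to_fls (f ^ N) * a = poly_to_fls t"
    "t = 0 \<or> degree t < degree (f ^ N)"
proof -
  obtain a b where a: "a \<in> AA" and b: "b \<in> BB" and x: "x = a + b"
    using QQ_decompose[OF assms, of 0] by auto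
  obtain N t where t: "poly_to_fls (f ^ N) * a = poly_to_fls t" 
    using a by (auto simp: AA_def loc_def)
  obtain q r where qr: "t = f ^ N * q + r" "r = 0 \<or> degree r < degree (f ^ N)"
    using monic_division[OF degree_monic_power(1)[OF monic_f]] by blast
  show ?thesis
  proof (rule that[of "a - poly_to_fls q" "b + poly_to_fls q" N r])
    show "poly_to_fls (f ^ N) * (a - poly_to_fls q) = poly_to_fls r"
      by (simp add: t qr(1) right_diff_distrib poly_to_fls.hom_add poly_to_fls.hom_mult)
  qed (use a b x qr in \<open>auto intro: A.diff_closed B.add_closed poly_in_AA poly_in_BB\<close>)
qed

text \<open>\<open>QQ\<close> is local: the alternative depends only on whether the numerator of
  \<open>x\<close> reduces to 0. It decides which entries can serve as pivots.\<close>

lemma QQ_unit_or_torsion: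
  assumes "x \<in> QQ"
  shows "(\<exists>y\<in>QQ. x * y = 1) \<or> poly_to_fls ([:\<pi>:] ^ e) * x = 0"
proof -
  obtain s t where s: "red s \<noteq> 0" and t: "poly_to_fls s * x = poly_to_fls t"
    using assms by (auto simp: QQ_def loc_def)
  show ?thesis
  proof (cases "red t = 0")
    case False
    then obtain y where y: "poly_to_fls t * y = 1" using regular_unit by blast
    then have "y \<in> QQ" unfolding QQ_def using False by (intro inverse_in_loc) auto
    moreover have "x * (poly_to_fls s * y) = 1" using y unfolding t[symmetric] by (simp only: ac_simps)
    ultimately show ?thesis using Q.mult_closed poly_in_QQ by blast
  next
    case True
    then obtain c where "t = [:\<pi>:] * c" unfolding red_eq_0_iff by (elim dvdE)
    then have "poly_to_fls ([:\<pi>:] ^ e) * poly_to_fls t = poly_to_fls ([:\<pi>:] ^ Suc e * c)"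
      by (simp only: poly_to_fls.hom_mult[symmetric] power_Suc2 mult.assoc)
    also have "\<dots> = 0" unfolding pi_const_power pi_power_eq_0 by simp
    finally have "poly_to_fls ([:\<pi>:] ^ e) * (poly_to_fls s * x) = 0" by (simp add: t)
    moreover obtain y where "poly_to_fls s * y = 1" using regular_unit s by blast
    ultimately have "poly_to_fls ([:\<pi>:] ^ e) * x = 0"
      using unit_cancel[of "poly_to_fls s" _ "poly_to_fls ([:\<pi>:] ^ e) * x" 0] by (simp add: ac_simps)
    then show ?thesis ..
  qed
qed

text \<open>Quotients of monic polynomials of equal degree: multiplication by them preserves degrees even
  though the coefficient ring has zero divisors.\<close>

definition HH where "HH = {w \<in> AA. (\<exists>w'\<in>AA. w * w' = 1) \<and>
  (\<exists>K m. monic m \<and> degree m = K * degree f \<and> poly_to_fls (f ^ K) * w = poly_to_fls m)}"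

lemma HH_one: "1 \<in> HH"
  unfolding HH_def using A.one_closed
  by (auto intro!: exI[of _ 0] exI[of "\<lambda>m. monic m \<and> _ m" 1] bexI[of _ 1])

lemma HH_mult:
  assumes "w \<in> HH" "x \<in> HH"
  shows "w * x \<in> HH"
proof -
  obtain w' K m where w: "w \<in> AA" "w' \<in> AA" "w * w' = 1" "monic m" "degree m = K * degree f"
    "poly_to_fls (f ^ K) * w = poly_to_fls m" using assms(1) by (auto simp: HH_def)
  obtain x' L l where x: "x \<in> AA" "x' \<in> AA" "x * x' = 1" "monic l" "degree l = L * degree f"
    "poly_to_fls (f ^ L) * x = poly_to_fls l" using assms(2) by (auto simp: HH_def)
  have "l \<noteq> 0" using x by auto
  have "poly_to_fls (f ^ (K + L)) * (w * x) = (poly_to_fls (f ^ K) * w) * (poly_to_fls (f ^ L) * x)"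
    by (simp add: power_add poly_to_fls.hom_mult ac_simps)
  then have "poly_to_fls (f ^ (K + L)) * (w * x) = poly_to_fls (m * l)"
    unfolding w x poly_to_fls.hom_mult .
  moreover have "monic (m * l)" using w x by (intro monic_times)
  moreover have "degree (m * l) = (K + L) * degree f"
    using w x degree_monic_mult[OF \<open>monic m\<close> \<open>l \<noteq> 0\<close>] by (simp add: algebra_simps)
  moreover have "(w * x) * (w' * x') = 1" by (rule unit_mult[OF w(3) x(3)])
  ultimately show ?thesis unfolding HH_def using w x A.mult_closed by blast
qed

lemma nilpotent_pi_fls: "j \<ge> 1 \<Longrightarrow> (poly_to_fls ([:\<pi>:] ^ j) * x) ^ Suc e = 0"
proof -
  assume "j \<ge> 1"
  then obtain i where i: "j = Suc i" by (cases j) auto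
  have "([:\<pi>:] ^ j) ^ Suc e = ([:\<pi>:] * [:\<pi>:] ^ i) ^ Suc e" by (simp only: i power_Suc)
  also have "\<dots> = 0" by (rule nilpotent_pi)
  finally show ?thesis by (simp only: power_mult_distrib poly_to_fls.hom_power[symmetric]) simp
qed

text \<open>The numerator is \<open>f ^ N\<close> plus a polynomial of smaller degree, so it keeps
  the leading term of \<open>f ^ N\<close>.\<close>

lemma one_plus_proper_HH:
  assumes a: "a \<in> AA" and j: "j \<ge> 1" and t: "poly_to_fls (f ^ N) * a = poly_to_fls t"
    "t = 0 \<or> degree t < degree (f ^ N)"
  shows "1 + poly_to_fls ([:\<pi>:] ^ j) * a \<in> HH"
proof -
  have c: "poly_to_fls ([:\<pi>:] ^ j) * a \<in> AA" by (intro A.mult_closed poly_in_AA a)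
  note mf = degree_monic_power[OF monic_f, of N]
  define r where "r = [:\<pi>:] ^ j * t"
  have "r = 0 \<or> degree r < degree (f ^ N)"
    using t(2) le_less_trans[OF degree_smult_le] unfolding r_def pi_const_power by auto
  then have "degree (f ^ N + r) = degree (f ^ N)" "coeff r (degree (f ^ N)) = 0"
    by (auto simp: degree_add_eq_left coeff_eq_0)
  then have "monic (f ^ N + r)" "degree (f ^ N + r) = N * degree f" using mf by auto
  moreover have "poly_to_fls (f ^ N) * (1 + poly_to_fls ([:\<pi>:] ^ j) * a) =
      poly_to_fls (f ^ N) + poly_to_fls ([:\<pi>:] ^ j) * (poly_to_fls (f ^ N) * a)"
    by (simp add: algebra_simps)
  then have "poly_to_fls (f ^ N) * (1 + poly_to_fls ([:\<pi>:] ^ j) * a) = poly_to_fls (f ^ N + r)"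
    unfolding t(1) r_def poly_to_fls.hom_mult poly_to_fls.hom_add .
  moreover have "\<exists>w'\<in>AA. (1 + poly_to_fls ([:\<pi>:] ^ j) * a) * w' = 1"
    by (rule A.one_plus_nilpotent_closed[OF c nilpotent_pi_fls[OF j]])
  moreover have "1 + poly_to_fls ([:\<pi>:] ^ j) * a \<in> AA" using c A.add_closed A.one_closed by blast
  ultimately show ?thesis unfolding HH_def by blast
qed

text \<open>Replacing \<open>1 + \<pi>\<^sup>j (a + b)\<close> by \<open>(1 + \<pi>\<^sup>j a) (1 + \<pi>\<^sup>j b)\<close> leaves an error factor of the same form with
  exponent \<open>j + 1\<close>, and \<open>\<pi>\<close> is nilpotent.\<close>

lemma one_plus_factor:
  assumes "z \<in> QQ" "j \<ge> 1"
  shows "\<exists>w\<in>HH. \<exists>v\<in>BB. \<exists>v'\<in>BB. v * v' = 1 \<and> 1 + poly_to_fls ([:\<pi>:] ^ j) * z = w * v"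
  using assms
proof (induction "Suc e - j" arbitrary: j z)
  case 0
  then have "Suc e \<le> j" by simp
  then have "\<pi> ^ j = 0" using pi_power_eq_0 by (metis le_iff_add power_add mult_zero_left)
  then have "poly_to_fls ([:\<pi>:] ^ j) * z = 0" by (simp add: pi_const_power)
  then show ?case using HH_one B.one_closed by (auto intro!: bexI[of _ 1])
next
  case (Suc d)
  define P where "P i = (poly_to_fls ([:\<pi>:] ^ i) :: 'a fls)" for i
  obtain a b N t where ab: "a \<in> AA" "b \<in> BB" "z = a + b" and
    t: "poly_to_fls (f ^ N) * a = poly_to_fls t" "t = 0 \<or> degree t < degree (f ^ N)"
    by (rule QQ_decompose_proper[OF Suc.prems(1)])
  have w: "1 + P j * a \<in> HH" unfolding P_def using one_plus_proper_HH ab Suc.prems t by blast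
  then obtain w' where w': "w' \<in> AA" "(1 + P j * a) * w' = 1" by (auto simp: HH_def)
  have "P j * b \<in> BB" unfolding P_def by (intro B.mult_closed poly_in_BB ab)
  then obtain v' where v: "1 + P j * b \<in> BB" and v': "v' \<in> BB" "(1 + P j * b) * v' = 1"
    using B.one_plus_nilpotent_closed[OF _ nilpotent_pi_fls[OF Suc.prems(2)]] B.add_closed B.one_closed
    unfolding P_def by metis
  \<comment> \<open>The product of the two factors exceeds \<open>1 + \<pi>\<^sup>j z\<close> by
    \<open>\<pi>\<^sup>2\<^sup>j a b\<close>; as \<open>j \<ge> 1\<close>, the factor
    \<open>\<pi>\<close> to the power \<open>j + 1\<close> can be taken out. Dividing the rest by
    both units \<open>1 + \<pi>\<^sup>j a\<close> and \<open>1 + \<pi>\<^sup>j b\<close> makes the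
    error multiplicative.\<close>
  define z' where "z' = - (P (j - 1) * a * b * w' * v')"
  have z': "z' \<in> QQ" unfolding z'_def P_def
    using ab w' v' AA_subset BB_subset by (intro Q.uminus_closed Q.mult_closed poly_in_QQ) auto
  have "P j * P j = P (j + 1) * P (j - 1)"
    using Suc.prems(2) unfolding P_def poly_to_fls.hom_mult[symmetric] power_add[symmetric] by simp
  then have "1 + P j * z = (1 + P j * a) * (1 + P j * b) - P (j + 1) * (P (j - 1) * a * b)"
    by (simp add: ab(3) algebra_simps)
  also have "P (j + 1) * (P (j - 1) * a * b) = 
    P (j + 1) * (P (j - 1) * a * b) * (((1 + P j * a) * w') * ((1 + P j * b) * v'))"
    using w' v' by simp
  also have "(1 + P j * a) * (1 + P j * b) - \<dots> =
     (1 + P j * a) * (1 + P j * b) * (1 + P (j + 1) * z')"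
    unfolding z'_def by (simp only: ring_distribs mult_1_left mult_1_right mult_minus_right minus_add_distrib diff_conv_add_uminus ac_simps)
  finally have 1: "1 + P j * z = (1 + P j * a) * (1 + P j * b) * (1 + P (j + 1) * z')" .
  have "d = Suc e - (j + 1)" "1 \<le> j + 1" using Suc.hyps(2) by auto
  from Suc.hyps(1)[OF this(1) z' this(2)] obtain w2 v2 v2' where
    2: "w2 \<in> HH" "v2 \<in> BB" "v2' \<in> BB" "v2 * v2' = 1" "1 + P (j + 1) * z' = w2 * v2"
    unfolding P_def by blast
  have "1 + P j * z = ((1 + P j * a) * w2) * ((1 + P j * b) * v2)" unfolding 1 2(5) by (simp add: ac_simps)
  moreover have "((1 + P j * b) * v2) * (v' * v2') = 1" by (rule unit_mult[OF v'(2) 2(4)])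
  ultimately show ?case using HH_mult[OF w 2(1)] B.mult_closed[OF v 2(2)] B.mult_closed[OF v'(1) 2(3)]
    unfolding P_def by blast
qed

end

section \<open>Approximation of matrices\<close>

text \<open>The matrix 1 + v e^T with e the unit vector at \<open>c\<close>. For
  \<open>v c = 0\<close> it is a product of elementary transvections with common pivot row
  \<open>c\<close>, so one such matrix clears a whole column.\<close>

definition transvection :: "nat \<Rightarrow> nat \<Rightarrow> (nat \<Rightarrow> 'a::comm_ring_1) \<Rightarrow> 'a mat" where
  "transvection k c v = mat k k (\<lambda>(i, j). (if i = j then 1 else 0) + (if j = c then v i else 0))"

definition dilation :: "nat \<Rightarrow> nat \<Rightarrow> 'a::comm_ring_1 \<Rightarrow> 'a mat" where
  "dilation k c d = mat k k (\<lambda>(i, j). if i = j then (if i = c then d else 1) else 0)"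

lemma transvection_carrier [simp]: "transvection k c v \<in> carrier_mat k k"
  by (simp add: transvection_def)

lemma dilation_carrier [simp]: "dilation k c d \<in> carrier_mat k k"
  by (simp add: dilation_def)

lemma index_transvection_mult:
  assumes "M \<in> carrier_mat k n" "c < k" "i < k" "j < n"
  shows "(transvection k c v * M) $$ (i, j) = M $$ (i, j) + v i * M $$ (c, j)"
  using assms by (auto simp: transvection_def scalar_prod_def distrib_right sum.distrib
      if_distrib[of "\<lambda>x. x * _"] sum.delta sum.delta' cong: if_cong)

lemma index_dilation_mult:
  assumes "M \<in> carrier_mat k n" "i < k" "j < n"
  shows "(dilation k c d * M) $$ (i, j) = (if i = c then d else 1) * M $$ (i, j)"
  using assms by (auto simp: dilation_def scalar_prod_def
      if_distrib[of "\<lambda>x. x * _"] sum.delta sum.delta' cong: if_cong)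

text \<open>In (1 + v e^T) (1 + w e^T) the cross term contains e^T w, which is
  \<open>w c = 0\<close>.\<close>

lemma transvection_mult:
  assumes "c < k" "w c = 0"
  shows "transvection k c v * transvection k c w = transvection k c (\<lambda>i. v i + w i)"
proof (rule eq_matI)
  fix i j assume "i < dim_row (transvection k c (\<lambda>i. v i + w i))" "j < dim_col (transvection k c (\<lambda>i. v i + w i))"
  then have ij: "i < k" "j < k" by (auto simp: transvection_def)
  then show "(transvection k c v * transvection k c w) $$ (i, j) = transvection k c (\<lambda>i. v i + w i) $$ (i, j)"
    using assms by (subst index_transvection_mult) (auto simp: transvection_def)
qed (auto simp: transvection_def)

lemma transvection_zero: "transvection k c (\<lambda>_. 0) = 1\<^sub>m k"
  by (rule eq_matI) (auto simp: transvection_def)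

lemma dilation_mult: "dilation k c x * dilation k c y = dilation k c (x * y)"
proof (rule eq_matI)
  fix i j assume "i < dim_row (dilation k c (x * y))" "j < dim_col (dilation k c (x * y))"
  then have "i < k" "j < k" by (auto simp: dilation_def)
  then show "(dilation k c x * dilation k c y) $$ (i, j) = dilation k c (x * y) $$ (i, j)"
    by (subst index_dilation_mult) (auto simp: dilation_def)
qed (auto simp: dilation_def)

lemma dilation_one: "dilation k c 1 = 1\<^sub>m k"
  by (rule eq_matI) (auto simp: dilation_def)

lemma det_dilation: "c < k \<Longrightarrow> det (dilation k c d) = d"
proof -
  assume c: "c < k"
  have "det (dilation k c d) = (\<Prod>i = 0..<k. dilation k c d $$ (i, i))"
    using det_upper_triangular[of "dilation k c d" k]
    by (auto simp: upper_triangular_def prod_list_diag_prod dilation_def)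
  also have "\<dots> = (\<Prod>i = 0..<k. if i = c then d else 1)"
    by (rule prod.cong) (auto simp: dilation_def)
  also have "\<dots> = d" using c by (simp add: prod.delta)
  finally show ?thesis .
qed

lemma det_transvection:
  assumes "c < k" "v c = 0"
  shows "det (transvection k c v) = 1"
proof -
  \<comment> \<open>Only the first \<open>m\<close> entries of \<open>v\<close> are switched on, so
    that each induction step multiplies by one elementary row addition.\<close>
  have "det (transvection k c (\<lambda>i. if i < m then v i else 0)) = 1" for m
  proof (induction m)
    case 0
    then show ?case by (simp add: transvection_zero)
  next
    case (Suc m)
    let ?u = "\<lambda>i. if i < m then v i else 0" and ?s = "\<lambda>i. if i = m then v i else 0"
    have 1: "det (transvection k c ?s) = 1"
    proof (cases "m = c")
      case True
      then have "?s = (\<lambda>_. 0)" using assms by auto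
      then show ?thesis by (simp only: transvection_zero det_one)
    next
      case False
      then have "transvection k c ?s = addrow_mat k (v m) m c"
        by (intro eq_matI) (auto simp: transvection_def)
      then show ?thesis using det_addrow_mat[OF False] by simp
    qed
    have "(\<lambda>i. ?s i + ?u i) = (\<lambda>i. if i < Suc m then v i else 0)" by (auto simp: less_Suc_eq)
    then have "transvection k c (\<lambda>i. if i < Suc m then v i else 0) = transvection k c ?s * transvection k c ?u"
      using transvection_mult[of c k ?u ?s] assms by simp
    then show ?case using 1 Suc.IH by (simp add: det_mult[of _ k])
  qed
  moreover have "transvection k c (\<lambda>i. if i < k then v i else 0) = transvection k c v"
    by (rule eq_matI) (auto simp: transvection_def)
  ultimately show ?thesis by metis
qed

lemma (in subring_set) mats_transvection: "(\<And>i. v i \<in> B) \<Longrightarrow> transvection k c v \<in> mats k k"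
  by (auto simp: mats_def transvection_def intro: one_closed zero_closed add_closed)

lemma (in subring_set) mats_dilation: "d \<in> B \<Longrightarrow> dilation k c d \<in> mats k k"
  by (auto simp: mats_def dilation_def intro: one_closed zero_closed)

section \<open>Approximation by invertible matrices over \<open>AA\<close> in the f-adic topology of
  \<open>BB\<close>\<close>

context residue_split
begin

text \<open>The principal congruence subgroup of level \<open>f ^ K\<close> in the general linear
  group over \<open>BB\<close>.\<close>

definition near_one :: "nat \<Rightarrow> nat \<Rightarrow> 'a fls mat \<Rightarrow> bool" where
  "near_one k K V \<longleftrightarrow> (\<exists>N\<in>B.mats k k. \<exists>W\<in>B.mats k k.
     V = 1\<^sub>m k + poly_to_fls (f ^ K) \<cdot>\<^sub>m N \<and> V * W = 1\<^sub>m k \<and> W * V = 1\<^sub>m k)"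

text \<open>\<open>U\<close> lies in the f-adic closure of the general linear group over
  \<open>AA\<close>. The final factorization takes \<open>K = 0\<close>, but products lose accuracy,
  so the property has to hold for all \<open>K\<close> to be multiplicative.\<close>

definition approximable :: "nat \<Rightarrow> 'a fls mat \<Rightarrow> bool" where
  "approximable k U \<longleftrightarrow> U \<in> carrier_mat k k \<and>
     (\<forall>K. \<exists>S\<in>A.mats k k. \<exists>T\<in>A.mats k k. S * T = 1\<^sub>m k \<and> T * S = 1\<^sub>m k \<and> near_one k K (U * S))"

lemma near_one_mats: "near_one k K V \<Longrightarrow> V \<in> B.mats k k"
  by (auto simp: near_one_def intro!: B.mats_add B.mats_one B.mats_smult poly_in_BB)

lemma near_one_one: "near_one k K (1\<^sub>m k)"
  unfolding near_one_def
  by (intro bexI[of _ "0\<^sub>m k k"] bexI[of _ "1\<^sub>m k"] B.mats_one)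
    (auto simp: B.mats_def intro: B.zero_closed)

lemma near_one_mult:
  assumes "near_one k K V1" "near_one k K V2"
  shows "near_one k K (V1 * V2)"
proof -
  let ?F = "poly_to_fls (f ^ K)"
  note m = near_one_mats[OF assms(1)] near_one_mats[OF assms(2)]
  obtain N1 W1 where 1: "N1 \<in> B.mats k k" "W1 \<in> B.mats k k" "V1 = 1\<^sub>m k + ?F \<cdot>\<^sub>m N1"
    "V1 * W1 = 1\<^sub>m k" "W1 * V1 = 1\<^sub>m k" using assms(1) by (auto simp: near_one_def)
  obtain N2 W2 where 2: "N2 \<in> B.mats k k" "W2 \<in> B.mats k k" "V2 = 1\<^sub>m k + ?F \<cdot>\<^sub>m N2"
    "V2 * W2 = 1\<^sub>m k" "W2 * V2 = 1\<^sub>m k" using assms(2) by (auto simp: near_one_def)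
  note c = B.mats_carrier[OF 1(1)] B.mats_carrier[OF 1(2)] B.mats_carrier[OF 2(1)] B.mats_carrier[OF 2(2)]
    B.mats_carrier[OF m(1)] B.mats_carrier[OF m(2)]
  have "V1 * V2 = V1 * 1\<^sub>m k + V1 * (?F \<cdot>\<^sub>m N2)"
    unfolding 2(3) using c by (intro mult_add_distrib_mat) auto
  also have "\<dots> = (1\<^sub>m k + ?F \<cdot>\<^sub>m N1) + ?F \<cdot>\<^sub>m (V1 * N2)"
    using c unfolding mult_smult_distrib[OF c(5,3)] 1(3)[symmetric] by simp
  also have "\<dots> = 1\<^sub>m k + ?F \<cdot>\<^sub>m (N1 + V1 * N2)"
    using c by (auto simp: add_smult_distrib_left_mat[of _ k k] intro!: assoc_add_mat[of _ k k])
  finally have e: "V1 * V2 = 1\<^sub>m k + ?F \<cdot>\<^sub>m (N1 + V1 * N2)" .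
  have "V1 * V2 * (W2 * W1) = V1 * ((V2 * W2) * W1)"
    using c by (simp add: assoc_mult_mat[of _ k k _ k _ k])
  then have f1: "V1 * V2 * (W2 * W1) = 1\<^sub>m k" using c 1 2 by simp
  have "W2 * W1 * (V1 * V2) = W2 * ((W1 * V1) * V2)"
    using c by (simp add: assoc_mult_mat[of _ k k _ k _ k])
  then have f2: "W2 * W1 * (V1 * V2) = 1\<^sub>m k" using c 1 2 by simp
  show ?thesis unfolding near_one_def
    using e f1 f2 B.mats_add[OF 1(1) B.mats_mult[OF m(1) 2(1)]] B.mats_mult[OF 2(2) 1(2)] by blast
qed

lemma AA_mats_denominator:
  assumes "M \<in> A.mats k n"
  shows "\<exists>m. poly_to_fls (f ^ m) \<cdot>\<^sub>m M \<in> B.mats k n"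
proof -
  have "\<exists>m t. poly_to_fls (f ^ m) * x = poly_to_fls t" if "x \<in> AA" for x
    using that by (auto simp: AA_def loc_def)
  then obtain \<mu> \<tau> where \<mu>: "poly_to_fls (f ^ \<mu> x) * x = poly_to_fls (\<tau> x)" if "x \<in> AA" for x by metis
  define m where "m = (\<Sum>(i, j)\<in>{..<k} \<times> {..<n}. \<mu> (M $$ (i, j)))"
  have "poly_to_fls (f ^ m) * M $$ (i, j) \<in> BB" if ij: "i < k" "j < n" for i j
  proof -
    have "\<mu> (M $$ (i, j)) \<le> m"
      unfolding m_def using member_le_sum[of "(i, j)" "{..<k} \<times> {..<n}" "\<lambda>(i, j). \<mu> (M $$ (i, j))"] ij by auto
    then obtain d where d: "m = d + \<mu> (M $$ (i, j))" by (metis le_iff_add add.commute)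
    have "poly_to_fls (f ^ m) * M $$ (i, j) = poly_to_fls (f ^ d) * (poly_to_fls (f ^ \<mu> (M $$ (i, j))) * M $$ (i, j))"
      unfolding d power_add poly_to_fls.hom_mult by (simp only: mult.assoc)
    also have "\<dots> = poly_to_fls (f ^ d * \<tau> (M $$ (i, j)))"
      using \<mu>[OF A.mats_entry[OF assms ij]] by (simp only: poly_to_fls.hom_mult)
    finally show ?thesis using poly_in_BB by simp
  qed
  then have "poly_to_fls (f ^ m) \<cdot>\<^sub>m M \<in> B.mats k n"
    using A.mats_carrier[OF assms] by (intro B.matsI) auto
  then show ?thesis ..
qed

text \<open>Conjugation by a matrix over \<open>AA\<close> introduces only a bounded power of
  \<open>f\<close> in the denominators, and a higher level absorbs it.\<close>

lemma near_one_conj: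
  assumes S: "S \<in> A.mats k k" and T: "T \<in> A.mats k k" and ST: "S * T = 1\<^sub>m k" "T * S = 1\<^sub>m k"
  shows "\<exists>K'. \<forall>V. near_one k K' V \<longrightarrow> near_one k K (T * V * S)"
proof -
  obtain m1 where m1: "poly_to_fls (f ^ m1) \<cdot>\<^sub>m T \<in> B.mats k k" using AA_mats_denominator[OF T] by blast
  obtain m2 where m2: "poly_to_fls (f ^ m2) \<cdot>\<^sub>m S \<in> B.mats k k" using AA_mats_denominator[OF S] by blast
  define F where "F i = (poly_to_fls (f ^ i) :: 'a fls)" for i
  note cS = A.mats_carrier[OF S] and cT = A.mats_carrier[OF T]
  have *: "\<exists>N\<in>B.mats k k. T * (1\<^sub>m k + F (K + m1 + m2) \<cdot>\<^sub>m X) * S = 1\<^sub>m k + F K \<cdot>\<^sub>m N"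
    if X: "X \<in> B.mats k k" for X
  proof
    note cX = B.mats_carrier[OF X]
    show "(F m1 \<cdot>\<^sub>m T) * X * (F m2 \<cdot>\<^sub>m S) \<in> B.mats k k"
      using m1 m2 X unfolding F_def by (intro B.mats_mult)
    have "(F m1 \<cdot>\<^sub>m T) * X * (F m2 \<cdot>\<^sub>m S) = (F m1 * F m2) \<cdot>\<^sub>m (T * X * S)"
      using cX cS cT by (intro eq_matI) (auto simp: mult_smult_assoc_mat[of _ k k] mult_smult_distrib[of _ k k] ac_simps)
    then have 1: "F K \<cdot>\<^sub>m ((F m1 \<cdot>\<^sub>m T) * X * (F m2 \<cdot>\<^sub>m S)) = F (K + m1 + m2) \<cdot>\<^sub>m (T * X * S)"
      by (intro eq_matI) (simp_all add: F_def power_add poly_to_fls.hom_mult mult.assoc)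
    have "T * (1\<^sub>m k + F (K + m1 + m2) \<cdot>\<^sub>m X) * S = (T * 1\<^sub>m k + T * (F (K + m1 + m2) \<cdot>\<^sub>m X)) * S"
      using cX cT by (subst mult_add_distrib_mat[of _ k k]) auto
    also have "\<dots> = T * S + F (K + m1 + m2) \<cdot>\<^sub>m (T * X) * S"
      using cX cT cS by (subst add_mult_distrib_mat[of _ k k]) (auto simp: mult_smult_distrib[of _ k k])
    also have "F (K + m1 + m2) \<cdot>\<^sub>m (T * X) * S = F (K + m1 + m2) \<cdot>\<^sub>m (T * X * S)"
      using cX cT cS by (intro mult_smult_assoc_mat[of _ k k]) auto
    finally show "T * (1\<^sub>m k + F (K + m1 + m2) \<cdot>\<^sub>m X) * S = 1\<^sub>m k + F K \<cdot>\<^sub>m ((F m1 \<cdot>\<^sub>m T) * X * (F m2 \<cdot>\<^sub>m S))"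
      using ST 1 by simp
  qed
  have "near_one k K (T * V * S)" if V: "near_one k (K + m1 + m2) V" for V
  proof -
    obtain N W where N: "N \<in> B.mats k k" and W: "W \<in> B.mats k k" and V: "V = 1\<^sub>m k + F (K + m1 + m2) \<cdot>\<^sub>m N"
      and VW: "V * W = 1\<^sub>m k" "W * V = 1\<^sub>m k" using V unfolding near_one_def F_def by blast
    note c = B.mats_carrier[OF N] B.mats_carrier[OF W]
    have cV: "V \<in> carrier_mat k k" using c unfolding V by auto
    \<comment> \<open>The inverse \<open>W\<close> must also be conjugated into \<open>BB\<close>.
      From \<open>V * W = 1\<^sub>m k\<close> it has the same shape as \<open>V\<close>, with
      \<open>- (N * W)\<close> in place of \<open>N\<close>.\<close>
    have NW: "- (N * W) \<in> B.mats k k" using N W by (intro B.mats_uminus B.mats_mult)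
    have "1\<^sub>m k = W + F (K + m1 + m2) \<cdot>\<^sub>m (N * W)"
      using VW(1) c unfolding V by (simp add: add_mult_distrib_mat[of _ k k] mult_smult_assoc_mat[of _ k k])
    then have WE: "W = 1\<^sub>m k + F (K + m1 + m2) \<cdot>\<^sub>m (- (N * W))"
      using c by (intro eq_matI) (auto simp: mat_eq_iff algebra_simps)
    obtain N1 where N1: "N1 \<in> B.mats k k" "T * V * S = 1\<^sub>m k + F K \<cdot>\<^sub>m N1" using *[OF N] V by blast
    obtain N2 where N2: "N2 \<in> B.mats k k" "T * W * S = 1\<^sub>m k + F K \<cdot>\<^sub>m N2" using *[OF NW] WE by metis
    have "T * W * S \<in> B.mats k k" unfolding N2(2) F_def
      by (intro B.mats_add B.mats_one B.mats_smult poly_in_BB N2)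
    have "(T * V * S) * (T * W * S) = T * (V * ((S * T) * (W * S)))"
      "(T * W * S) * (T * V * S) = T * (W * ((S * T) * (V * S)))"
      using cV c cS cT by (simp_all add: assoc_mult_mat[of _ k k _ k _ k])
    moreover have "V * (W * S) = S" "W * (V * S) = S"
      using cV c cS VW by (simp_all add: assoc_mult_mat[of _ k k _ k _ k, symmetric])
    ultimately have "(T * V * S) * (T * W * S) = 1\<^sub>m k" "(T * W * S) * (T * V * S) = 1\<^sub>m k"
      using cV c cS cT ST by simp_all
    then show ?thesis unfolding near_one_def
      using N1 \<open>T * W * S \<in> B.mats k k\<close> unfolding F_def by blast
  qed
  then show ?thesis by blast
qed

text \<open>\<open>U1 U2 S2 S1\<close> equals \<open>(U1 S1) (T1 (U2 S2) S1)\<close>. So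
  \<open>S1\<close> is chosen first, and then \<open>S2\<close> with accuracy high enough to survive
  conjugation by \<open>S1\<close>.\<close>

lemma approximable_mult:
  assumes 1: "approximable k U1" and 2: "approximable k U2"
  shows "approximable k (U1 * U2)"
  unfolding approximable_def
proof (intro conjI allI)
  have c: "U1 \<in> carrier_mat k k" "U2 \<in> carrier_mat k k" using 1 2 by (auto simp: approximable_def)
  then show "U1 * U2 \<in> carrier_mat k k" by auto
  fix K
  obtain S1 T1 where S1: "S1 \<in> A.mats k k" "T1 \<in> A.mats k k" "S1 * T1 = 1\<^sub>m k" "T1 * S1 = 1\<^sub>m k"
    "near_one k K (U1 * S1)" using 1 unfolding approximable_def by blast
  from near_one_conj[OF S1(1-4)] obtain K' where K': "\<And>V. near_one k K' V \<Longrightarrow> near_one k K (T1 * V * S1)" by blast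
  obtain S2 T2 where S2: "S2 \<in> A.mats k k" "T2 \<in> A.mats k k" "S2 * T2 = 1\<^sub>m k" "T2 * S2 = 1\<^sub>m k"
    "near_one k K' (U2 * S2)" using 2 unfolding approximable_def by blast
  note cs = A.mats_carrier[OF S1(1)] A.mats_carrier[OF S1(2)] A.mats_carrier[OF S2(1)] A.mats_carrier[OF S2(2)]
  have "near_one k K ((U1 * S1) * (T1 * (U2 * S2) * S1))"
    by (intro near_one_mult S1 K' S2)
  also have "(U1 * S1) * (T1 * (U2 * S2) * S1) = U1 * ((S1 * T1) * (U2 * S2 * S1))"
    using c cs by (simp add: assoc_mult_mat[of _ k k _ k _ k])
  also have "\<dots> = U1 * U2 * (S2 * S1)"
    using c cs S1(3) by (simp add: assoc_mult_mat[of _ k k _ k _ k])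
  finally have n: "near_one k K (U1 * U2 * (S2 * S1))" .
  have "S2 * S1 * (T1 * T2) = S2 * ((S1 * T1) * T2)" "T1 * T2 * (S2 * S1) = T1 * ((T2 * S2) * S1)"
    using cs by (simp_all add: assoc_mult_mat[of _ k k _ k _ k])
  then have "S2 * S1 * (T1 * T2) = 1\<^sub>m k" "T1 * T2 * (S2 * S1) = 1\<^sub>m k" using cs S1 S2 by simp_all
  then show "\<exists>S\<in>A.mats k k. \<exists>T\<in>A.mats k k. S * T = 1\<^sub>m k \<and> T * S = 1\<^sub>m k \<and> near_one k K (U1 * U2 * S)"
    using n A.mats_mult[OF S2(1) S1(1)] A.mats_mult[OF S1(2) S2(2)] by blast
qed

lemma approximable_transvection:
  assumes v: "\<And>i. v i \<in> QQ" and c: "c < k" "v c = 0"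
  shows "approximable k (transvection k c v)"
  unfolding approximable_def
proof (intro conjI allI)
  fix K
  let ?F = "poly_to_fls (f ^ K)"
  \<comment> \<open>The splitting is not unique, so at the index \<open>c\<close> both parts are set
    to 0 explicitly; otherwise the transvections would not add.\<close>
  have "\<exists>a b. a \<in> AA \<and> b \<in> BB \<and> v i = a + ?F * b \<and> (i = c \<longrightarrow> a = 0 \<and> b = 0)" for i
  proof (cases "i = c")
    case True
    then show ?thesis using c A.zero_closed B.zero_closed by auto
  next
    case False
    then show ?thesis using QQ_decompose[OF v[of i], of K] by blast
  qed
  then obtain a b where a: "\<And>i. a i \<in> AA" and b: "\<And>i. b i \<in> BB" and ab: "\<And>i. v i = a i + ?F * b i"
    and ac: "a c = 0" "b c = 0" by metis
  let ?S = "transvection k c (\<lambda>i. - a i)" and ?T = "transvection k c a"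
  have S: "?S \<in> A.mats k k" "?T \<in> A.mats k k" by (auto intro!: A.mats_transvection A.uminus_closed a)
  have "?S * ?T = 1\<^sub>m k" "?T * ?S = 1\<^sub>m k"
    using ac c by (simp_all add: transvection_mult transvection_zero)
  moreover have "near_one k K (transvection k c v * ?S)"
    unfolding near_one_def
  proof (intro bexI conjI)
    have VS: "transvection k c v * ?S = transvection k c (\<lambda>i. ?F * b i)"
      using ac c ab by (simp add: transvection_mult)
    show "transvection k c v * ?S = 1\<^sub>m k + ?F \<cdot>\<^sub>m mat k k (\<lambda>(i, j). if j = c then b i else 0)"
      unfolding VS by (rule eq_matI) (auto simp: transvection_def)
    show "transvection k c v * ?S * transvection k c (\<lambda>i. - (?F * b i)) = 1\<^sub>m k"
      "transvection k c (\<lambda>i. - (?F * b i)) * (transvection k c v * ?S) = 1\<^sub>m k"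
      unfolding VS using ac c by (simp_all add: transvection_mult transvection_zero)
    show "transvection k c (\<lambda>i. - (?F * b i)) \<in> B.mats k k"
      by (intro B.mats_transvection B.uminus_closed B.mult_closed poly_in_BB b)
    show "mat k k (\<lambda>(i, j). if j = c then b i else 0) \<in> B.mats k k"
      by (rule B.matsI) (auto intro: b B.zero_closed)
  qed
  ultimately show "\<exists>S\<in>A.mats k k. \<exists>T\<in>A.mats k k. S * T = 1\<^sub>m k \<and> T * S = 1\<^sub>m k \<and> near_one k K (transvection k c v * S)"
    using S by blast
qed simp

lemma approximable_dilation:
  assumes "d \<in> AA" "d' \<in> AA" "d * d' = 1"
  shows "approximable k (dilation k c d)"
  unfolding approximable_def
proof (intro conjI allI bexI)
  show 1: "dilation k c d' * dilation k c d = 1\<^sub>m k" "dilation k c d * dilation k c d' = 1\<^sub>m k"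
    using assms by (simp_all add: dilation_mult dilation_one mult.commute)
  show "near_one k K (dilation k c d * dilation k c d')" for K
    unfolding 1 by (rule near_one_one)
qed (auto intro: A.mats_dilation assms)

end

section \<open>Elimination and factorization of matrices over \<open>QQ\<close>\<close>

context residue_split
begin

lemma approximable_transvection_mult:
  assumes "approximable k (transvection k c v * U)" and U: "U \<in> carrier_mat k k"
    and v: "\<And>i. v i \<in> QQ" "c < k" "v c = 0"
  shows "approximable k U"
proof -
  have "transvection k c (\<lambda>i. - v i) * (transvection k c v * U) =
      (transvection k c (\<lambda>i. - v i) * transvection k c v) * U"
    using U by (simp add: assoc_mult_mat[of _ k k _ k _ k])
  also have "\<dots> = U" using v U by (simp add: transvection_mult transvection_zero)
  finally show ?thesis
    using approximable_mult[OF approximable_transvection assms(1), of "\<lambda>i. - v i" c] v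
    by (simp add: Q.uminus_closed)
qed

text \<open>Column elimination over the local ring \<open>QQ\<close>; a pivot exists because otherwise \<open>\<pi>\<^sup>e\<close> times a
  vector with an entry 1 would lie in the kernel of \<open>U\<close>.\<close>

lemma approximable_eliminate:
  assumes "c < k" and "U \<in> Q.mats k k"
    and "det U = w" and "w \<in> AA" "w' \<in> AA" "w * w' = 1"
    and "\<And>i j. j < c \<Longrightarrow> i < k \<Longrightarrow> U $$ (i, j) = (if i = j then 1 else 0)"
  shows "approximable k U"
  using assms
proof (induction "k - 1 - c" arbitrary: c U)
  case 0
  then have k: "k = Suc c" by simp
  note U = Q.mats_carrier[OF 0(3)]
  have "upper_triangular U" using U 0(8) k by (auto simp: upper_triangular_def)
  then have "w = (\<Prod>i = 0..<k. U $$ (i, i))"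
    using det_upper_triangular[OF _ U] U 0(4) by (simp add: prod_list_diag_prod)
  also have "\<dots> = U $$ (c, c)" using 0(8) unfolding k by simp
  finally have w: "U $$ (c, c) = w" ..
  \<comment> \<open>Only column \<open>c\<close> is left, with \<open>w\<close> on the diagonal;
    \<open>v\<close> holds the entries above it divided by \<open>w\<close>.\<close>
  define v where "v i = (if i < c then U $$ (i, c) * w' else 0)" for i
  have "U = transvection k c v * dilation k c w"
  proof (rule eq_matI)
    fix i j assume "i < dim_row (transvection k c v * dilation k c w)" "j < dim_col (transvection k c v * dilation k c w)"
    then have ij: "i < k" "j < k" by (auto simp: transvection_def dilation_def)
    show "U $$ (i, j) = (transvection k c v * dilation k c w) $$ (i, j)"
    proof (cases "j = c")
      case True
      have "U $$ (i, c) * w' * w = U $$ (i, c)" using 0(7) by (metis mult.assoc mult.commute mult_1)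
      then show ?thesis using True ij 0(2) w
        by (subst index_transvection_mult[of _ k k]) (auto simp: dilation_def v_def k)
    next
      case False
      then show ?thesis using ij 0(2,8)
        by (subst index_transvection_mult[of _ k k]) (auto simp: dilation_def k)
    qed
  qed (use U in \<open>auto simp: transvection_def dilation_def\<close>)
  moreover have "v i \<in> QQ" for i
    using 0 AA_subset unfolding v_def by (auto intro!: Q.mult_closed Q.mats_entry[OF 0(3)] Q.zero_closed)
  ultimately show ?case
    using approximable_mult[OF approximable_transvection approximable_dilation[OF 0(5-7)], of v c k c] 0(2)
    by (simp add: v_def)
next
  case (Suc d)
  from Suc.hyps(2) have c: "Suc c < k" "d = k - 1 - Suc c" by auto
  have op: "transvection k b v * V \<in> Q.mats k k \<and> det (transvection k b v * V) = w \<and>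
      (\<forall>j<c. \<forall>i<k. (transvection k b v * V) $$ (i, j) = (if i = j then 1 else 0))"
    if V: "V \<in> Q.mats k k" "det V = w" "\<And>i j. j < c \<Longrightarrow> i < k \<Longrightarrow> V $$ (i, j) = (if i = j then 1 else 0)"
      and v: "\<And>i. v i \<in> QQ" "v b = 0" "b < k" "c \<le> b" for b v V
  proof (intro conjI allI impI)
    show "transvection k b v * V \<in> Q.mats k k" by (rule Q.mats_mult[OF Q.mats_transvection[of v, OF v(1)] V(1)])
    show "det (transvection k b v * V) = w"
      using det_mult[of "transvection k b v" k V] det_transvection[of b k v, OF v(3,2)] Q.mats_carrier[OF V(1)] V(2) by simp
    fix i j assume "j < c" "i < k"
    then show "(transvection k b v * V) $$ (i, j) = (if i = j then 1 else 0)"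
      using V v Q.mats_carrier[OF V(1)] Suc.prems(1) by (subst index_transvection_mult[of _ k k]) auto
  qed
  \<comment> \<open>Pivot equal to 1: one transvection clears the column, and the induction
    hypothesis takes over at the next one.\<close>
  have one: "approximable k V"
    if V: "V \<in> Q.mats k k" "det V = w" "\<And>i j. j < c \<Longrightarrow> i < k \<Longrightarrow> V $$ (i, j) = (if i = j then 1 else 0)"
      and 1: "V $$ (c, c) = 1" for V
  proof -
    define v where "v i = (if i < k \<and> i \<noteq> c then - V $$ (i, c) else 0)" for i
    have v: "v i \<in> QQ" "v c = 0" for i
      using Suc.prems(1) unfolding v_def by (auto intro!: Q.uminus_closed Q.mats_entry[OF V(1)] Q.zero_closed)
    note o = op[where V = V and v = v and b = c, OF V v Suc.prems(1) order_refl]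
    have "approximable k (transvection k c v * V)"
    proof (rule Suc.hyps(1)[OF c(2) c(1)])
      fix i j assume ij: "j < Suc c" "i < k"
      show "(transvection k c v * V) $$ (i, j) = (if i = j then 1 else 0)"
      proof (cases "j = c")
        case True
        then show ?thesis using 1 ij Suc.prems(1) Q.mats_carrier[OF V(1)]
          by (subst index_transvection_mult[of _ k k]) (auto simp: v_def)
      qed (use o ij in auto)
    qed (use o Suc.prems in auto)
    from approximable_transvection_mult[OF this Q.mats_carrier[OF V(1)] v(1) Suc.prems(1) v(2)] show ?thesis .
  qed
  \<comment> \<open>Unit below the diagonal: adding a multiple of row \<open>b\<close> to row
    \<open>c\<close> makes the pivot 1. Scaling a row instead would change the determinant and need
    not be approximable.\<close>
  have two: "approximable k V"
    if V: "V \<in> Q.mats k k" "det V = w" "\<And>i j. j < c \<Longrightarrow> i < k \<Longrightarrow> V $$ (i, j) = (if i = j then 1 else 0)"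
      and i: "c < b" "b < k" and q: "q \<in> QQ" "V $$ (b, c) * q = 1" for V b q
  proof -
    define v where "v i = (if i = c then (1 - V $$ (c, c)) * q else 0)" for i
    have v: "v i \<in> QQ" "v b = 0" for i
      using Suc.prems(1) i q unfolding v_def
      by (auto intro!: Q.mult_closed Q.diff_closed Q.one_closed Q.mats_entry[OF V(1)] Q.zero_closed)
    have o: "transvection k b v * V \<in> Q.mats k k" "det (transvection k b v * V) = w"
      "\<And>i j. j < c \<Longrightarrow> i < k \<Longrightarrow> (transvection k b v * V) $$ (i, j) = (if i = j then 1 else 0)"
      using op[where V = V and v = v and b = b, OF V v i(2)] i by auto
    have "(1 - V $$ (c, c)) * q * V $$ (b, c) = 1 - V $$ (c, c)" using q(2) by (metis mult.assoc mult.commute mult_1)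
    then have "(transvection k b v * V) $$ (c, c) = 1"
      using i Suc.prems(1) Q.mats_carrier[OF V(1)] by (subst index_transvection_mult[of _ k k]) (auto simp: v_def)
    from approximable_transvection_mult[OF one[OF o this] Q.mats_carrier[OF V(1)] v(1) i(2) v(2)] show ?thesis .
  qed
  \<comment> \<open>Unit on the diagonal: it is used to put 1 just below it, which reduces to the
    previous case. Row \<open>Suc c\<close> exists because \<open>c\<close> is not the last
    column.\<close>
  have three: "approximable k V"
    if V: "V \<in> Q.mats k k" "det V = w" "\<And>i j. j < c \<Longrightarrow> i < k \<Longrightarrow> V $$ (i, j) = (if i = j then 1 else 0)"
      and q: "q \<in> QQ" "V $$ (c, c) * q = 1" for V q
  proof -
    define v where "v i = (if i = Suc c then (1 - V $$ (Suc c, c)) * q else 0)" for i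
    have v: "v i \<in> QQ" "v c = 0" for i
      using Suc.prems(1) c q unfolding v_def
      by (auto intro!: Q.mult_closed Q.diff_closed Q.one_closed Q.mats_entry[OF V(1)] Q.zero_closed)
    have o: "transvection k c v * V \<in> Q.mats k k" "det (transvection k c v * V) = w"
      "\<And>i j. j < c \<Longrightarrow> i < k \<Longrightarrow> (transvection k c v * V) $$ (i, j) = (if i = j then 1 else 0)"
      using op[where V = V and v = v and b = c, OF V v Suc.prems(1)] by auto
    have "(1 - V $$ (Suc c, c)) * q * V $$ (c, c) = 1 - V $$ (Suc c, c)"
      using q(2) by (metis mult.assoc mult.commute mult_1)
    then have "(transvection k c v * V) $$ (Suc c, c) * 1 = 1"
      using c Suc.prems(1) Q.mats_carrier[OF V(1)] by (subst index_transvection_mult[of _ k k]) (auto simp: v_def)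
    from approximable_transvection_mult[OF two[OF o _ c(1) Q.one_closed this] Q.mats_carrier[OF V(1)] v(1) Suc.prems(1) v(2)]
    show ?thesis by simp
  qed
  let ?P = "poly_to_fls ([:\<pi>:] ^ e)"
  note U = Q.mats_carrier[OF Suc.prems(2)]
  have "\<exists>i. c \<le> i \<and> i < k \<and> (\<exists>q\<in>QQ. U $$ (i, c) * q = 1)"
  proof (rule ccontr)
    assume "\<not> ?thesis"
    then have tors: "?P * U $$ (i, c) = 0" if "c \<le> i" "i < k" for i
      using that QQ_unit_or_torsion[OF Q.mats_entry[OF Suc.prems(2)], of i c] Suc.prems(1) by blast
    \<comment> \<open>The columns before \<open>c\<close> are unit vectors, so the entries of
      \<open>?P\<close> times column \<open>c\<close> above the diagonal can be cancelled; the
      remaining ones are 0 by torsion.\<close>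
    define x where "x = vec k (\<lambda>j. if j = c then ?P else if j < c then - (?P * U $$ (j, c)) else 0)"
    have "U *\<^sub>v x = 0\<^sub>v k"
    proof (rule eq_vecI)
      fix i assume "i < dim_vec (0\<^sub>v k :: 'a fls vec)"
      then have i: "i < k" by simp
      have "(U *\<^sub>v x) $ i = (\<Sum>j = 0..<k. U $$ (i, j) * x $ j)"
        using U i by (simp add: scalar_prod_def x_def)
      also have "\<dots> = (\<Sum>j \<in> {0..<Suc c}. U $$ (i, j) * x $ j)"
        using Suc.prems(1) by (intro sum.mono_neutral_right) (auto simp: x_def)
      also have "\<dots> = (\<Sum>j = 0..<c. U $$ (i, j) * x $ j) + U $$ (i, c) * ?P"
        using Suc.prems(1) by (simp add: x_def)
      also have "(\<Sum>j = 0..<c. U $$ (i, j) * x $ j) = (\<Sum>j = 0..<c. if j = i then - (?P * U $$ (i, c)) else 0)"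
        using Suc.prems(1,7) i by (intro sum.cong) (auto simp: x_def)
      also have "\<dots> = (if i < c then - (?P * U $$ (i, c)) else 0)"
        by (subst sum.delta) auto
      finally show "(U *\<^sub>v x) $ i = 0\<^sub>v k $ i"
        using tors[of i] i by (cases "i < c") (auto simp: mult.commute)
    qed (use U in auto)
    have x: "x \<in> carrier_vec k" by (simp add: x_def)
    \<comment> \<open>By the adjugate, the determinant kills every kernel vector; as
      \<open>w\<close> is a unit, the entry \<open>?P\<close> of \<open>x\<close> would be
      0.\<close>
    have "w \<cdot>\<^sub>v x = (adj_mat U * U) *\<^sub>v x"
      unfolding adj_mat(3)[OF U] Suc.prems(3)
      using x by (intro eq_vecI) (auto simp: scalar_prod_def if_distrib[of "\<lambda>z. _ * z"]
          if_distrib[of "\<lambda>z. z * _"] sum.delta sum.delta' cong: if_cong)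
    also have "\<dots> = adj_mat U *\<^sub>v (U *\<^sub>v x)" using adj_mat(1)[OF U] U x by (rule assoc_mult_mat_vec)
    also have "\<dots> = 0\<^sub>v k" unfolding \<open>U *\<^sub>v x = 0\<^sub>v k\<close> using adj_mat(1)[OF U] by auto
    finally have "(w \<cdot>\<^sub>v x) $ c = 0" using Suc.prems(1) by simp
    then have "w * ?P = 0" using Suc.prems(1) x by (simp add: x_def)
    then have "?P = 0" using Suc.prems(6) by (metis mult.assoc mult.commute mult_1 mult_zero_right)
    then show False using pi_power_neq_0 by (simp add: pi_const_power)
  qed
  then obtain i q where i: "c \<le> i" "i < k" "q \<in> QQ" "U $$ (i, c) * q = 1" by blast
  show ?case
  proof (cases "i = c")
    case True
    show ?thesis by (rule three[of U q]) (use Suc.prems i True in simp_all)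
  next
    case False
    show ?thesis by (rule two[of U i q]) (use Suc.prems i False in simp_all)
  qed
qed

text \<open>Scaling row 0 of \<open>U\<close> by \<open>v'\<close> leaves the determinant
  \<open>w\<close>, a unit of \<open>AA\<close>, so elimination applies to the result
  \<open>U0\<close> and gives \<open>T = W * U0\<close> with \<open>T\<close> over \<open>AA\<close>
  and \<open>W\<close> over \<open>BB\<close>. A second scaling then corrects the determinant of
  \<open>T\<close>.\<close>

lemma matrix_factorization:
  assumes "0 < k" and U: "U \<in> Q.mats k k" and det: "det U = w * v"
    and w: "w \<in> AA" "w' \<in> AA" "w * w' = 1" and v: "v \<in> BB" "v' \<in> BB" "v * v' = 1"
  shows "\<exists>T\<in>A.mats k k. \<exists>W\<in>B.mats k k. T = W * U \<and> det T = w"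
proof -
  note cU = Q.mats_carrier[OF U]
  let ?D = "dilation k 0 v'"
  define U0 where "U0 = ?D * U"
  have U0: "U0 \<in> Q.mats k k" unfolding U0_def using v BB_subset by (intro Q.mats_mult[OF Q.mats_dilation U]) auto
  note cU0 = Q.mats_carrier[OF U0]
  have "det U0 = w" using v(3) \<open>0 < k\<close> cU
    by (simp add: U0_def det_mult[of _ k] det_dilation det mult.left_commute[of v']) (simp add: mult.commute)
  then have "approximable k U0" by (intro approximable_eliminate[OF \<open>0 < k\<close> U0 _ w]) auto
  then obtain S T where S: "S \<in> A.mats k k" and T: "T \<in> A.mats k k" and ST: "S * T = 1\<^sub>m k" "T * S = 1\<^sub>m k"
    and V: "near_one k 0 (U0 * S)" unfolding approximable_def by blast
  from V obtain W where W: "W \<in> B.mats k k" "W * (U0 * S) = 1\<^sub>m k" unfolding near_one_def by blast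
  note c = A.mats_carrier[OF S] A.mats_carrier[OF T] B.mats_carrier[OF W(1)]
  \<comment> \<open>\<open>\<delta>\<close> lies in \<open>BB\<close> as a determinant over
    \<open>BB\<close> and in \<open>AA\<close> as \<open>w * det S\<close>, so scaling by it is
    allowed on both sides. As \<open>det S * det T = 1\<close>, it turns \<open>det T\<close> into
    \<open>w\<close>.\<close>
  define \<delta> where "\<delta> = det (U0 * S)"
  have \<delta>: "\<delta> = w * det S" unfolding \<delta>_def using c cU0 \<open>det U0 = w\<close> by (simp add: det_mult[of _ k])
  have "\<delta> \<in> BB" unfolding \<delta>_def by (rule B.det_closed[OF near_one_mats[OF V]])
  have "\<delta> \<in> AA" unfolding \<delta> by (rule A.mult_closed[OF w(1) A.det_closed[OF S]])
  have "det S * det T = 1" using arg_cong[OF ST(1), of det] c by (simp add: det_mult[of _ k])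
  let ?E = "dilation k 0 \<delta>"
  have "T = W * (U0 * S) * T" using W c by simp
  also have "\<dots> = W * (U0 * (S * T))" using c cU0 by (simp add: assoc_mult_mat[of _ k k _ k _ k])
  also have "\<dots> = W * U0" using ST cU0 c by simp
  finally have "T = W * U0" .
  then have "?E * T = (?E * W * ?D) * U"
    using c cU by (simp add: U0_def assoc_mult_mat[of _ k k _ k _ k])
  moreover have "det (?E * T) = w"
    using c \<open>0 < k\<close> \<open>det S * det T = 1\<close> by (simp add: det_mult[of _ k] det_dilation \<delta> mult.assoc)
  moreover have "?E * T \<in> A.mats k k" using \<open>\<delta> \<in> AA\<close> by (rule A.mats_mult[OF A.mats_dilation T])
  moreover have "?E * W * ?D \<in> B.mats k k" using \<open>\<delta> \<in> BB\<close> by (intro B.mats_mult[OF B.mats_mult[OF B.mats_dilation W(1)] B.mats_dilation] v)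
  ultimately show ?thesis by blast
qed

end

section \<open>Minors and encoders\<close>

lemma submatrix_UNIV_carrier:
  assumes "G \<in> carrier_mat k n" "J \<subseteq> {..<n}" "card J = m"
  shows "submatrix G UNIV J \<in> carrier_mat k m"
proof -
  have "{j. j < n \<and> j \<in> J} = J" using assms(2) by auto
  then show ?thesis using assms by (auto simp: dim_submatrix)
qed

lemma submatrix_UNIV_index:
  assumes "G \<in> carrier_mat k n" "J \<subseteq> {..<n}" "card J = m" "i < k" "j < m"
  shows "submatrix G UNIV J $$ (i, j) = G $$ (i, pick J j)" "pick J j < n"
proof -
  have J: "{j. j < n \<and> j \<in> J} = J" using assms(2) by auto
  then show "submatrix G UNIV J $$ (i, j) = G $$ (i, pick J j)"
    using assms by (subst submatrix_index) (auto simp: pick_UNIV)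
  show "pick J j < n" using pick_le[of j n J] J assms by auto
qed

lemma submatrix_UNIV_mult:
  assumes U: "U \<in> carrier_mat l k" and G: "G \<in> carrier_mat k n" and J: "J \<subseteq> {..<n}" "card J = m"
  shows "submatrix (U * G) UNIV J = U * submatrix G UNIV J"
proof (rule eq_matI)
  note cG = submatrix_UNIV_carrier[OF G J] and cUG = submatrix_UNIV_carrier[OF mult_carrier_mat[OF U G] J]
  fix i j assume "i < dim_row (U * submatrix G UNIV J)" "j < dim_col (U * submatrix G UNIV J)"
  then have ij: "i < l" "j < m" using U cG by auto
  have "submatrix (U * G) UNIV J $$ (i, j) = (U * G) $$ (i, pick J j)"
    by (rule submatrix_UNIV_index[OF mult_carrier_mat[OF U G] J ij])
  also have "\<dots> = (\<Sum>a = 0..<k. U $$ (i, a) * G $$ (a, pick J j))"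
    using U G ij submatrix_UNIV_index(2)[OF mult_carrier_mat[OF U G] J ij] by (simp add: scalar_prod_def)
  also have "\<dots> = (\<Sum>a = 0..<k. U $$ (i, a) * submatrix G UNIV J $$ (a, j))"
    by (intro sum.cong refl) (simp add: submatrix_UNIV_index[OF G J _ ij(2)])
  also have "\<dots> = (U * submatrix G UNIV J) $$ (i, j)"
    using U cG ij by (simp add: scalar_prod_def)
  finally show "submatrix (U * G) UNIV J $$ (i, j) = (U * submatrix G UNIV J) $$ (i, j)" .
qed (use U G J in \<open>auto simp: dim_submatrix\<close>)

lemma submatrix_UNIV_map:
  assumes G: "G \<in> carrier_mat k n" and J: "J \<subseteq> {..<n}" "card J = m"
  shows "submatrix (map_mat h G) UNIV J = map_mat h (submatrix G UNIV J)"
proof (rule eq_matI)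
  have G': "map_mat h G \<in> carrier_mat k n" using G by simp
  fix i j assume "i < dim_row (map_mat h (submatrix G UNIV J))" "j < dim_col (map_mat h (submatrix G UNIV J))"
  then have ij: "i < k" "j < m" using submatrix_UNIV_carrier[OF G J] by auto
  then show "submatrix (map_mat h G) UNIV J $$ (i, j) = map_mat h (submatrix G UNIV J) $$ (i, j)"
    using submatrix_UNIV_index[OF G' J ij] submatrix_UNIV_index[OF G J ij] submatrix_UNIV_carrier[OF G J] G
    by auto
qed (use G in \<open>auto simp: dim_submatrix\<close>)

lemma full_minors_image:
  assumes "G \<in> carrier_mat k n"
  shows "full_minors G = (\<lambda>J. det (submatrix G UNIV J)) ` {J. J \<subseteq> {..<n} \<and> card J = k}"
  using assms by (auto simp: full_minors_def)

lemma det_submatrix_mult: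
  assumes "U \<in> carrier_mat k k" "G \<in> carrier_mat k n" "J \<subseteq> {..<n}" "card J = k"
  shows "det (submatrix (U * G) UNIV J) = det U * det (submatrix G UNIV J)"
  using assms by (simp add: submatrix_UNIV_mult[of _ k k _ n _ k] det_mult[OF _ submatrix_UNIV_carrier])

lemma det_submatrix_map:
  assumes "comm_ring_hom h" "G \<in> carrier_mat k n" "J \<subseteq> {..<n}" "card J = k"
  shows "det (submatrix (map_mat h G) UNIV J) = h (det (submatrix G UNIV J))"
  using assms by (simp add: submatrix_UNIV_map[of _ k n _ k] comm_ring_hom.hom_det)

lemma encode_index:
  assumes "G \<in> carrier_mat k n" "u \<in> carrier_vec k" "j < n"
  shows "encode G u $ j = (\<Sum>i = 0..<k. u $ i * poly_to_fls (G $$ (i, j)))"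
  using assms by (auto simp: encode_def scalar_prod_def mult.commute intro!: sum.cong)

lemma encode_carrier: "G \<in> carrier_mat k n \<Longrightarrow> encode G u \<in> carrier_vec n"
  by (rule carrier_vecI) (auto simp: encode_def)

text \<open>Row \<open>i\<close> of \<open>U\<close> is an input from which \<open>G1\<close>
  produces the \<open>i\<close>-th row of \<open>G2\<close>, the codeword of a unit vector.\<close>

lemma conv_code_subset_imp_left_mult:
  assumes G1: "G1 \<in> carrier_mat k n" and G2: "G2 \<in> carrier_mat k n"
    and sub: "conv_code G2 \<subseteq> conv_code G1"
  shows "\<exists>U\<in>carrier_mat k k. U * map_mat poly_to_fls G1 = map_mat poly_to_fls G2"
proof -
  have "\<exists>u\<in>carrier_vec k. encode G1 u = encode G2 (unit_vec k i)" for i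
  proof -
    have "encode G2 (unit_vec k i) \<in> conv_code G2" using G2 by (auto simp: conv_code_def)
    then show ?thesis using sub G1 by (fastforce simp: conv_code_def)
  qed
  then obtain u where u: "\<And>i. u i \<in> carrier_vec k" "\<And>i. encode G1 (u i) = encode G2 (unit_vec k i)" by metis
  define U where "U = mat k k (\<lambda>(i, j). u i $ j)"
  have "U * map_mat poly_to_fls G1 = map_mat poly_to_fls G2"
  proof (rule eq_matI)
    fix i j assume "i < dim_row (map_mat poly_to_fls G2)" "j < dim_col (map_mat poly_to_fls G2)"
    then have ij: "i < k" "j < n" using G2 by auto
    have "(U * map_mat poly_to_fls G1) $$ (i, j) = encode G1 (u i) $ j"
      using ij G1 by (simp add: encode_index[OF G1 u(1) ij(2)] scalar_prod_def U_def)
    also have "\<dots> = encode G2 (unit_vec k i) $ j" by (simp add: u)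
    also have "\<dots> = map_mat poly_to_fls G2 $$ (i, j)"
      using ij G2 by (subst encode_index[of _ k n])
        (auto simp: if_distrib[of "\<lambda>x. x * _"] sum.delta cong: if_cong)
    finally show "(U * map_mat poly_to_fls G1) $$ (i, j) = map_mat poly_to_fls G2 $$ (i, j)" .
  qed (use G1 G2 in \<open>auto simp: U_def\<close>)
  then show ?thesis by (intro bexI[of _ U]) (auto simp: U_def)
qed

text \<open>Encoding \<open>u\<close> by \<open>G'\<close> is encoding the transpose of
  \<open>T\<close> times \<open>u\<close> by \<open>G\<close>, and an invertible \<open>T\<close>
  only permutes the inputs.\<close>

lemma equivalent_of_left_mult:
  assumes G: "generator_matrix k n G" and G': "G' \<in> carrier_mat k n"
    and T: "T \<in> carrier_mat k k" "T' \<in> carrier_mat k k" "T * T' = 1\<^sub>m k" "T' * T = 1\<^sub>m k"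
    and eq: "map_mat poly_to_fls G' = T * map_mat poly_to_fls G"
  shows "equivalent_generators k n G G'"
proof -
  have cG: "G \<in> carrier_mat k n" and fr: "full_rank G" using G by (auto simp: generator_matrix_def)
  have tT: "transpose_mat T * transpose_mat T' = 1\<^sub>m k" "transpose_mat T' * transpose_mat T = 1\<^sub>m k"
    using T by (auto simp flip: transpose_mult)
  have e: "encode G' u = encode G (transpose_mat T *\<^sub>v u)" if "u \<in> carrier_vec k" for u
    using that T cG G' unfolding encode_def eq
    by (subst transpose_mult[of _ k k]) (auto simp: assoc_mult_mat_vec[of _ n k _ k])
  have i1: "transpose_mat T *\<^sub>v (transpose_mat T' *\<^sub>v u) = u"
    "transpose_mat T' *\<^sub>v (transpose_mat T *\<^sub>v u) = u" if "u \<in> carrier_vec k" for u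
    using that T tT by (simp_all flip: assoc_mult_mat_vec[of _ k k _ k])
  have "full_rank G'"
    unfolding full_rank_def
  proof (intro ballI impI)
    fix u assume "u \<in> carrier_vec (dim_row G')" "encode G' u = 0\<^sub>v (dim_col G')"
    then have u: "u \<in> carrier_vec k" "encode G (transpose_mat T *\<^sub>v u) = 0\<^sub>v n" using G' e by auto
    have "transpose_mat T *\<^sub>v u \<in> carrier_vec k" using T u by auto
    then have "transpose_mat T *\<^sub>v u = 0\<^sub>v k" using fr u cG unfolding full_rank_def by auto
    then have "u = transpose_mat T' *\<^sub>v 0\<^sub>v k" using i1(2)[OF u(1)] by simp
    then show "u = 0\<^sub>v (dim_row G')" using T G' by (auto intro!: eq_vecI)
  qed
  moreover have "conv_code G = conv_code G'"
  proof -
    have "encode G ` carrier_vec k = encode G' ` carrier_vec k"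
    proof (intro equalityI subsetI; elim imageE)
      fix x u assume u: "u \<in> carrier_vec k" "x = encode G u"
      then have "x = encode G' (transpose_mat T' *\<^sub>v u)" using e[of "transpose_mat T' *\<^sub>v u"] i1 T by auto
      then show "x \<in> encode G' ` carrier_vec k" using u T by auto
    next
      fix x u assume "u \<in> carrier_vec k" "x = encode G' u"
      then show "x \<in> encode G ` carrier_vec k" using e T by auto
    qed
    then show ?thesis using cG G' by (simp add: conv_code_def)
  qed
  ultimately show ?thesis using G G' by (auto simp: equivalent_generators_def generator_matrix_def)
qed

lemma pick_strict_mono_image:
  assumes "\<And>i j. i < j \<Longrightarrow> j < k \<Longrightarrow> f i < (f j :: nat)" and "i < k"
  shows "pick (f ` {..<k}) i = f i"
proof -
  have "{a \<in> f ` {..<k}. a < f i} = f ` {..<i}"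
  proof (intro equalityI subsetI)
    fix a assume "a \<in> {a \<in> f ` {..<k}. a < f i}"
    then obtain j where "a = f j" "j < k" "f j < f i" by auto
    then show "a \<in> f ` {..<i}" using assms by (metis imageI lessThan_iff linorder_neqE_nat order.asym)
  qed (use assms in auto)
  moreover have "inj_on f {..<i}"
    using assms by (intro linorder_inj_onI) (auto simp: order_less_imp_not_eq)
  ultimately have "card {a \<in> f ` {..<k}. a < f i} = i" by (simp add: card_image)
  then show ?thesis using pick_card_in_set[of "f i" "f ` {..<k}"] assms(2) by auto
qed

lemma fract_common_denominator:
  fixes x :: "nat \<Rightarrow> 'a::idom fract"
  shows "\<exists>d a. d \<noteq> 0 \<and> (\<forall>j<k. to_fract (a j) = to_fract d * x j)"
proof (induction k)
  case 0
  then show ?case by (auto intro: exI[of _ 1])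
next
  case (Suc k)
  then obtain d a where d: "d \<noteq> 0" "\<And>j. j < k \<Longrightarrow> to_fract (a j) = to_fract d * x j" by blast
  obtain p q where pq: "x k = Fract p q" "q \<noteq> 0" by (cases "x k") auto
  have xk: "to_fract q * x k = to_fract p"
    using pq by (simp add: to_fract_def eq_fract)
  show ?case
  proof (intro exI conjI allI impI)
    show "d * q \<noteq> 0" using d pq by simp
    fix j assume "j < Suc k"
    then show "to_fract ((\<lambda>j. if j = k then d * p else q * a j) j) = to_fract (d * q) * x j"
      using d(2)[of j] xk by (auto simp: less_Suc_eq ac_simps)
  qed
qed

context residue_map
begin

text \<open>Row reduction over the fraction field of the reduced polynomials. A row without pivot
  would be a relation between the reduced rows; lifted and multiplied by \<open>\<pi> ^ e\<close> it
  becomes a relation between the rows of \<open>G\<close>, against full rank. So every row has a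
  pivot, and the pivot columns carry the minor.\<close>

lemma regular_full_minor:
  assumes G: "G \<in> carrier_mat k n" and fr: "full_rank G"
  shows "\<exists>J. J \<subseteq> {..<n} \<and> card J = k \<and> red (det (submatrix G UNIV J)) \<noteq> 0"
proof -
  let ?h = "\<lambda>g. to_fract (red g)"
  interpret h: comm_ring_hom ?h by unfold_locales (auto simp: hom_distribs)
  define M where "M = map_mat ?h G"
  have M: "M \<in> carrier_mat k n" using G by (simp add: M_def)
  define C where "C = gauss_jordan_single M"
  note gj = gauss_jordan_single[OF M C_def[symmetric]]
  note cC = gj(2)
  obtain P Q where PQ: "C = P * M" "P \<in> carrier_mat k k" "Q \<in> carrier_mat k k" "P * Q = 1\<^sub>m k" "Q * P = 1\<^sub>m k"
    using gj(4) by blast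
  obtain p where "pivot_fun C p (dim_col C)" using gj(3) by (auto simp: row_echelon_form_def)
  then have "pivot_fun C p n" using cC by simp
  note p = pivot_funD[OF _ this, of k]
  have dC: "dim_row C = k" using cC by simp
  have pn: "p i < n" if i: "i < k" for i
  proof (rule ccontr)
    assume "\<not> p i < n"
    then have zero: "C $$ (i, l) = 0" if "l < n" for l using p(2)[OF dC i, of l] that by simp
    obtain d a where da: "d \<noteq> 0 \<and> (\<forall>j<k. to_fract (a j) = to_fract d * P $$ (i, j))"
      using fract_common_denominator[of k "\<lambda>j. P $$ (i, j)"] by (elim exE)
    have a: "to_fract (a j) = to_fract d * P $$ (i, j)" if "j < k" for j
      by (rule da[THEN conjunct2, rule_format, OF that])
    define b where "b j = (SOME g. red g = a j)" for j
    have b: "red (b j) = a j" for j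
    proof -
      obtain g where "red g = a j" by (rule lift_poly)
      then show ?thesis unfolding b_def by (rule someI[where P = "\<lambda>g. red g = a j"])
    qed
    have red0: "red (\<Sum>j = 0..<k. b j * G $$ (j, l)) = 0" if l: "l < n" for l
    proof -
      have "?h (\<Sum>j = 0..<k. b j * G $$ (j, l)) = (\<Sum>j = 0..<k. to_fract d * (P $$ (i, j) * M $$ (j, l)))"
        unfolding h.hom_sum
      proof (rule sum.cong[OF refl])
        fix j assume "j \<in> {0..<k}"
        then have j: "j < k" by simp
        then have "M $$ (j, l) = ?h (G $$ (j, l))" using G l by (simp add: M_def)
        then show "?h (b j * G $$ (j, l)) = to_fract d * (P $$ (i, j) * M $$ (j, l))"
          unfolding h.hom_mult b a[OF j] by (simp only: mult.assoc)
      qed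
      also have "\<dots> = to_fract d * C $$ (i, l)"
        using PQ(1,2) M i l by (simp add: scalar_prod_def sum_distrib_left)
      finally show ?thesis using zero[OF l] by simp
    qed
    \<comment> \<open>The combination with coefficients \<open>b j\<close> is a multiple of
      \<open>\<pi>\<close>, so the factor \<open>\<pi> ^ e\<close> kills it. Then
      \<open>u = 0\<close> forces all \<open>b j\<close> to reduce to 0, that is, row
      \<open>i\<close> of the invertible \<open>P\<close> to vanish.\<close>
    define u where "u = vec k (\<lambda>j. poly_to_fls ([:\<pi>:] ^ e * b j))"
    have "encode G u = 0\<^sub>v n"
    proof (rule eq_vecI)
      fix l assume "l < dim_vec (0\<^sub>v n :: 'a fls vec)"
      then have l: "l < n" by simp
      obtain c where c: "(\<Sum>j = 0..<k. b j * G $$ (j, l)) = [:\<pi>:] * c"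
        using red0[OF l] unfolding red_eq_0_iff by (elim dvdE)
      have "encode G u $ l = poly_to_fls ([:\<pi>:] ^ e * (\<Sum>j = 0..<k. b j * G $$ (j, l)))"
        using l G by (subst encode_index[of _ k n])
          (auto simp: u_def poly_to_fls.hom_mult poly_to_fls.hom_sum sum_distrib_left mult.assoc)
      also have "[:\<pi>:] ^ e * (\<Sum>j = 0..<k. b j * G $$ (j, l)) = [:\<pi>:] ^ Suc e * c"
        unfolding c by (simp only: power_Suc2 mult.assoc)
      also have "\<dots> = 0" unfolding pi_const_power pi_power_eq_0 by simp
      finally show "encode G u $ l = 0\<^sub>v n $ l" using l by simp
    qed (use encode_carrier[OF G, of u] in auto)
    then have "u = 0\<^sub>v k" using fr G unfolding full_rank_def by (auto simp: u_def)
    have "P $$ (i, j) = 0" if j: "j < k" for j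
    proof (rule ccontr)
      assume "P $$ (i, j) \<noteq> 0"
      then have "red (b j) \<noteq> 0" using a[OF j] da b by auto
      then have "[:\<pi>:] ^ e * b j \<noteq> 0" by (rule pi_power_regular)
      moreover have "poly_to_fls ([:\<pi>:] ^ e * b j) = u $ j" using j by (simp add: u_def)
      ultimately show False using \<open>u = 0\<^sub>v k\<close> j by simp
    qed
    then have "(P * Q) $$ (i, i) = 0" using i PQ(2,3) by (simp add: scalar_prod_def)
    then show False using PQ(4) i by simp
  qed
  have mono: "p i < p j" if "i < j" "j < k" for i j
    using that
  proof (induction j)
    case (Suc j)
    have "p j < p (Suc j)" using p(3)[OF dC, of j] pn[of "Suc j"] Suc.prems by auto
    then show ?case using Suc by (cases "i = j") auto
  qed simp
  define J where "J = p ` {..<k}"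
  have J: "J \<subseteq> {..<n}" using pn by (auto simp: J_def)
  have "inj_on p {..<k}"
    using mono by (intro linorder_inj_onI) (auto simp: order_less_imp_not_eq)
  then have cJ: "card J = k" by (simp add: J_def card_image)
  have "submatrix C UNIV J = 1\<^sub>m k"
  proof (rule eq_matI)
    fix i j assume "i < dim_row (1\<^sub>m k :: 'k poly fract mat)" "j < dim_col (1\<^sub>m k :: 'k poly fract mat)"
    then have ij: "i < k" "j < k" by auto
    have "submatrix C UNIV J $$ (i, j) = C $$ (i, p j)"
      using submatrix_UNIV_index[OF cC J cJ ij] pick_strict_mono_image[OF mono ij(2)] by (simp add: J_def)
    also have "\<dots> = 1\<^sub>m k $$ (i, j)"
      using p(4)[OF dC ij(2) pn] p(5)[OF dC ij(2) pn _ , of i] ij by auto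
    finally show "submatrix C UNIV J $$ (i, j) = 1\<^sub>m k $$ (i, j)" .
  qed (use submatrix_UNIV_carrier[OF cC J cJ] in auto)
  then have "det P * det (submatrix M UNIV J) = 1"
    using det_submatrix_mult[OF PQ(2) M J cJ] PQ(1) by simp
  then have "?h (det (submatrix G UNIV J)) \<noteq> 0"
    using det_submatrix_map[OF h.comm_ring_hom_axioms G J cJ] unfolding M_def by auto
  then show ?thesis using J cJ by auto
qed

end

section \<open>Lowering the internal degree\<close>

context residue_split
begin

text \<open>With u = t/s, the congruence between \<open>t * f\<close> and \<open>h * s\<close>
  modulo \<open>\<pi>\<close> gives \<open>f u = h (1 + \<pi> z)\<close> with \<open>z\<close> in
  \<open>QQ\<close>. If the last factor splits as \<open>w0 * v0\<close>, then \<open>w\<close> is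
  w0/f and \<open>v\<close> is \<open>h v0\<close>, where \<open>h\<close> is a unit of
  \<open>BB\<close>.\<close>

lemma determinant_factorization:
  assumes s: "red s \<noteq> 0" and u: "u * poly_to_fls s = poly_to_fls t"
    and ts: "red t * red f = red h * red s" and h: "coprime (red h) (red f)"
  shows "\<exists>w w0 v v'. w \<in> AA \<and> w0 \<in> HH \<and> poly_to_fls f * w = w0 \<and> (\<exists>w'\<in>AA. w * w' = 1) \<and>
    v \<in> BB \<and> v' \<in> BB \<and> v * v' = 1 \<and> u = w * v"
proof -
  have "red (t * f - h * s) = 0" using ts by (simp add: hom_distribs)
  then obtain c where c: "t * f - h * s = [:\<pi>:] * c" unfolding red_eq_0_iff by (elim dvdE)
  obtain S where S: "poly_to_fls s * S = 1" using regular_unit[OF s] by blast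
  obtain H where H: "poly_to_fls h * H = 1" using regular_unit[OF coprime_regular[OF h]] by blast
  obtain F where F: "poly_to_fls f * F = 1" using regular_unit[OF red_f(1)] by blast
  have "S \<in> QQ" unfolding QQ_def by (rule inverse_in_loc[OF _ S]) (simp add: s)
  have "H \<in> BB" unfolding BB_def by (rule inverse_in_loc[OF _ H]) (simp add: h)
  have "F \<in> AA" unfolding AA_def by (rule inverse_in_loc[OF _ F]) (rule range_eqI[of _ _ 1], simp)
  define z where "z = poly_to_fls c * S * H"
  have z: "z \<in> QQ" unfolding z_def
    using \<open>S \<in> QQ\<close> \<open>H \<in> BB\<close> BB_subset by (intro Q.mult_closed poly_in_QQ) auto
  have tf: "t * f = h * s + [:\<pi>:] ^ 1 * c" using c by (simp add: algebra_simps)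
  have "poly_to_fls f * u = (poly_to_fls s * S) * (poly_to_fls f * u)" using S by simp
  also have "\<dots> = S * poly_to_fls (t * f)" unfolding poly_to_fls.hom_mult u[symmetric] by (simp only: ac_simps)
  also have "\<dots> = poly_to_fls h * (poly_to_fls s * S) + poly_to_fls ([:\<pi>:] ^ 1) * (poly_to_fls c * S)"
    unfolding tf poly_to_fls.hom_add poly_to_fls.hom_mult by (simp only: ring_distribs ac_simps)
  also have "\<dots> = poly_to_fls h + (poly_to_fls h * H) * (poly_to_fls ([:\<pi>:] ^ 1) * (poly_to_fls c * S))"
    using S H by simp
  also have "\<dots> = poly_to_fls h * (1 + poly_to_fls ([:\<pi>:] ^ 1) * z)"
    unfolding z_def by (simp only: ring_distribs ac_simps mult_1_left mult_1_right)
  finally have fu: "poly_to_fls f * u = poly_to_fls h * (1 + poly_to_fls ([:\<pi>:] ^ 1) * z)" .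
  obtain w0 v0 v0' where w0: "w0 \<in> HH" and v0: "v0 \<in> BB" "v0' \<in> BB" "v0 * v0' = 1"
    and z1: "1 + poly_to_fls ([:\<pi>:] ^ 1) * z = w0 * v0"
    using one_plus_factor[OF z, of 1] by auto
  obtain w0' where w0': "w0 \<in> AA" "w0' \<in> AA" "w0 * w0' = 1" using w0 by (auto simp: HH_def)
  have "u = F * (poly_to_fls h * (w0 * v0))" by (rule unit_cancel[OF F]) (simp only: fu z1)
  then have "u = (F * w0) * (poly_to_fls h * v0)" by (simp only: ac_simps)
  moreover have "F * w0 \<in> AA" by (rule A.mult_closed[OF \<open>F \<in> AA\<close> w0'(1)])
  moreover have "poly_to_fls f * (F * w0) = w0" using F by (simp add: mult.assoc[symmetric])
  moreover have "(F * w0) * (poly_to_fls f * w0') = 1" 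
    using unit_mult[OF F w0'(3)] by (simp only: ac_simps)
  moreover have "poly_to_fls f * w0' \<in> AA" by (rule A.mult_closed[OF poly_in_AA w0'(2)])
  moreover have "(poly_to_fls h * v0) * (H * v0') = 1" by (rule unit_mult[OF H v0(3)])
  moreover have "poly_to_fls h * v0 \<in> BB" by (rule B.mult_closed[OF poly_in_BB v0(1)])
  moreover have "H * v0' \<in> BB" by (rule B.mult_closed[OF \<open>H \<in> BB\<close> v0(2)])
  ultimately show ?thesis using w0 by blast
qed

text \<open>Clearing denominators gives \<open>f ^ Suc K * g' = m * g\<close>, where both left
  factors are monic and their degrees differ by \<open>degree f\<close>.\<close>

lemma degree_decrease:
  assumes w0: "w0 \<in> HH" and w: "poly_to_fls f * w = w0"
    and g: "poly_to_fls g' = w * poly_to_fls g" and "g' \<noteq> 0"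
  shows "degree g' < degree g"
proof -
  obtain K m where m: "monic m" "degree m = K * degree f" "poly_to_fls (f ^ K) * w0 = poly_to_fls m"
    using w0 by (auto simp: HH_def)
  have "poly_to_fls (f ^ Suc K * g') = poly_to_fls (f ^ K) * (poly_to_fls f * w) * poly_to_fls g"
    unfolding power_Suc poly_to_fls.hom_mult g by (simp only: ac_simps)
  also have "\<dots> = poly_to_fls (m * g)" unfolding w m(3) poly_to_fls.hom_mult ..
  finally have e: "f ^ Suc K * g' = m * g" by (simp only: poly_to_fls.eq_iff)
  have "g \<noteq> 0" using g \<open>g' \<noteq> 0\<close> by auto
  note F = degree_monic_power[OF monic_f, of "Suc K"]
  have "degree (f ^ Suc K * g') = Suc K * degree f + degree g'"
    unfolding degree_monic_mult[OF F(1) \<open>g' \<noteq> 0\<close>] F(2) ..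
  moreover have "degree (m * g) = K * degree f + degree g"
    unfolding degree_monic_mult[OF m(1) \<open>g \<noteq> 0\<close>] m(2) ..
  ultimately show ?thesis using e degree_f by simp
qed

text \<open>Cramer's rule: \<open>det M1\<close> times \<open>U\<close> is the polynomial matrix
  \<open>M2 * adj_mat M1\<close>.\<close>

lemma QQ_mats_of_left_mult:
  assumes U: "U \<in> carrier_mat k k" and M: "M1 \<in> carrier_mat k k" "M2 \<in> carrier_mat k k"
    and eq: "U * map_mat poly_to_fls M1 = map_mat poly_to_fls M2" and reg: "red (det M1) \<noteq> 0"
  shows "U \<in> Q.mats k k"
proof (rule Q.matsI[OF U])
  fix i j assume ij: "i < k" "j < k"
  note adj = adj_mat[OF M(1)]
  have "map_mat poly_to_fls (M2 * adj_mat M1) = map_mat poly_to_fls M2 * map_mat poly_to_fls (adj_mat M1)"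
    by (rule poly_to_fls.mat_hom_mult[OF M(2) adj(1)])
  also have "\<dots> = U * (map_mat poly_to_fls M1 * map_mat poly_to_fls (adj_mat M1))"
    unfolding eq[symmetric] using U M adj(1) by (simp add: assoc_mult_mat[of _ k k _ k _ k])
  also have "map_mat poly_to_fls M1 * map_mat poly_to_fls (adj_mat M1) = map_mat poly_to_fls (det M1 \<cdot>\<^sub>m 1\<^sub>m k)"
    unfolding poly_to_fls.mat_hom_mult[OF M(1) adj(1), symmetric] adj(2) ..
  also have "\<dots> = poly_to_fls (det M1) \<cdot>\<^sub>m 1\<^sub>m k"
    by (intro eq_matI) (auto simp: poly_to_fls.hom_mult)
  also have "U * (poly_to_fls (det M1) \<cdot>\<^sub>m 1\<^sub>m k) = poly_to_fls (det M1) \<cdot>\<^sub>m U"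
    using U by (subst mult_smult_distrib[OF U one_carrier_mat]) simp
  finally have "map_mat poly_to_fls (M2 * adj_mat M1) $$ (i, j) = (poly_to_fls (det M1) \<cdot>\<^sub>m U) $$ (i, j)" by simp
  then have "poly_to_fls (det M1) * U $$ (i, j) = poly_to_fls ((M2 * adj_mat M1) $$ (i, j))"
    using ij U M adj(1) by (simp del: index_mult_mat(1))
  then show "U $$ (i, j) \<in> QQ" unfolding QQ_def using reg by (intro locI) auto
qed

lemma exists_smaller_intdeg:
  assumes "0 < k" and G1: "generator_matrix k n G1" and G2: "G2 \<in> carrier_mat k n"
    and U: "U \<in> carrier_mat k k" "U * map_mat poly_to_fls G1 = map_mat poly_to_fls G2"
    and J: "J \<subseteq> {..<n}" "card J = k" and reg: "red (det (submatrix G1 UNIV J)) \<noteq> 0"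
    and h: "coprime (red h) (red f)"
    and quot: "red (det (submatrix G2 UNIV J)) * red f = red h * red (det (submatrix G1 UNIV J))"
  shows "\<exists>G'. equivalent_generators k n G1 G' \<and> intdeg G' < intdeg G1"
proof -
  have cG1: "G1 \<in> carrier_mat k n" using G1 by (simp add: generator_matrix_def)
  let ?M = "map_mat poly_to_fls"
  have cM: "?M G1 \<in> carrier_mat k n" "?M G2 \<in> carrier_mat k n" using cG1 G2 by auto
  have sub: "det (submatrix (?M G) UNIV J') = poly_to_fls (det (submatrix G UNIV J'))"
    if "G \<in> carrier_mat k n" "J' \<subseteq> {..<n}" "card J' = k" for G :: "'a poly mat" and J'
    by (rule det_submatrix_map[OF poly_to_fls.comm_ring_hom_axioms that])
  have dU: "det U * poly_to_fls (det (submatrix G1 UNIV J)) = poly_to_fls (det (submatrix G2 UNIV J))"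
    using det_submatrix_mult[OF U(1) cM(1) J] unfolding U(2) sub[OF G2 J] sub[OF cG1 J] by simp
  have "U \<in> Q.mats k k"
  proof (rule QQ_mats_of_left_mult[OF U(1) _ _ _ reg])
    show "U * ?M (submatrix G1 UNIV J) = ?M (submatrix G2 UNIV J)"
      using submatrix_UNIV_mult[OF U(1) cM(1) J] unfolding U(2)
      by (simp only: submatrix_UNIV_map[OF cG1 J] submatrix_UNIV_map[OF G2 J])
  qed (rule submatrix_UNIV_carrier[OF _ J], fact)+
  obtain w w0 w' v v' where w: "w \<in> AA" "w0 \<in> HH" "poly_to_fls f * w = w0" "w' \<in> AA" "w * w' = 1"
    and v: "v \<in> BB" "v' \<in> BB" "v * v' = 1" and det: "det U = w * v"
    using determinant_factorization[OF reg dU quot h] by blast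
  obtain T W where T: "T \<in> A.mats k k" and W: "W \<in> B.mats k k" and TW: "T = W * U" and dT: "det T = w"
    using matrix_factorization[OF \<open>0 < k\<close> \<open>U \<in> Q.mats k k\<close> det w(1,4,5) v] by blast
  note cT = A.mats_carrier[OF T] and cW = B.mats_carrier[OF W]
  have "T * ?M G1 \<in> A.mats k n"
    using cM by (intro A.mats_mult[OF T] A.matsI) (auto intro: poly_in_AA)
  moreover have "T * ?M G1 = W * ?M G2"
    unfolding TW U(2)[symmetric] using cW U cM by (intro assoc_mult_mat) auto
  moreover have "W * ?M G2 \<in> B.mats k n"
    using cM by (intro B.mats_mult[OF W] B.matsI) (auto intro: poly_in_BB)
  ultimately have "\<exists>t. (T * ?M G1) $$ (i, j) = poly_to_fls t" if "i < k" "j < n" for i j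
    using AA_Int_BB A.mats_entry B.mats_entry that by metis
  then obtain g where g: "\<And>i j. i < k \<Longrightarrow> j < n \<Longrightarrow> (T * ?M G1) $$ (i, j) = poly_to_fls (g i j)" by metis
  define G' where "G' = mat k n (\<lambda>(i, j). g i j)"
  have cG': "G' \<in> carrier_mat k n" by (simp add: G'_def)
  have MG': "?M G' = T * ?M G1"
  proof (rule eq_matI)
    fix i j assume "i < dim_row (T * ?M G1)" "j < dim_col (T * ?M G1)"
    then have ij: "i < k" "j < n" using cT cG1 by auto
    show "?M G' $$ (i, j) = (T * ?M G1) $$ (i, j)" unfolding g[OF ij] using ij by (simp add: G'_def)
  qed (use cT cG1 cG' in auto)
  note adj = adj_mat[OF cT]
  \<comment> \<open>The adjugate divided by the unit \<open>w\<close> inverts \<open>T\<close>, so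
    the code does not change.\<close>
  have "w' \<cdot>\<^sub>m (w \<cdot>\<^sub>m 1\<^sub>m k) = 1\<^sub>m k"
    using w(5) by (intro eq_matI) (auto simp: mult.commute)
  then have "T * (w' \<cdot>\<^sub>m adj_mat T) = 1\<^sub>m k" "(w' \<cdot>\<^sub>m adj_mat T) * T = 1\<^sub>m k"
    using adj cT unfolding dT
    by (simp_all add: mult_smult_distrib[of _ k k] mult_smult_assoc_mat[of _ k k])
  then have equiv: "equivalent_generators k n G1 G'"
    using adj by (intro equivalent_of_left_mult[OF G1 cG' cT _ _ _ MG']) auto
  have minor: "poly_to_fls (det (submatrix G' UNIV J')) = w * poly_to_fls (det (submatrix G1 UNIV J'))"
    if "J' \<subseteq> {..<n}" "card J' = k" for J'
    using det_submatrix_mult[OF cT cM(1) that] dT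
    unfolding MG'[symmetric] sub[OF cG' that] sub[OF cG1 that] by simp
  note dec = degree_decrease[OF w(2,3) minor]
  have fin: "finite {J. J \<subseteq> {..<n} \<and> card J = k}" by (rule finite_subset[of _ "Pow {..<n}"]) auto
  have le: "degree (det (submatrix G1 UNIV J')) \<le> intdeg G1" if "J' \<subseteq> {..<n}" "card J' = k" for J'
    unfolding intdeg_def full_minors_image[OF cG1] using fin that by (intro Max_ge) auto
  \<comment> \<open>A vanishing minor of \<open>G'\<close> counts with degree 0, so the strict
    inequality needs \<open>0 < intdeg G1\<close>. The minor at \<open>J\<close> stays nonzero and
    its degree drops, which provides this.\<close>
  have "det (submatrix G1 UNIV J) \<noteq> 0" using reg by auto
  moreover have "w' * (w * poly_to_fls (det (submatrix G1 UNIV J))) = poly_to_fls (det (submatrix G1 UNIV J))"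
    using w(5) by (simp add: mult.assoc[symmetric] mult.commute[of w'])
  ultimately have "det (submatrix G' UNIV J) \<noteq> 0" using minor[OF J] by auto
  from dec[OF J this] le[OF J] have pos: "0 < intdeg G1" by linarith
  have "degree (det (submatrix G' UNIV J')) < intdeg G1" if "J' \<subseteq> {..<n}" "card J' = k" for J'
    using dec[OF that] le[OF that] pos by (cases "det (submatrix G' UNIV J') = 0") auto
  then have "intdeg G' < intdeg G1"
    unfolding intdeg_def[of G'] full_minors_image[OF cG'] using fin J by (subst Max_less_iff) auto
  with equiv show ?thesis by blast
qed

end

section \<open>Comparison of the gcds of the reduced minors\<close>

context residue_map
begin

lemma RIDM_Gcd_dvd:
  assumes "RIDM k n G1" and eq: "equivalent_generators k n G1 G2"
  shows "Gcd (full_minors (map_mat red G1)) dvd Gcd (full_minors (map_mat red G2))"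
proof (cases "k = 0")
  case True
  then have "G1 = G2" using eq by (auto simp: equivalent_generators_def generator_matrix_def)
  then show ?thesis by simp
next
  case False
  have G1: "generator_matrix k n G1" "G1 \<in> carrier_mat k n" "full_rank G1" and G2: "G2 \<in> carrier_mat k n"
    and code: "conv_code G2 \<subseteq> conv_code G1"
    using eq by (auto simp: equivalent_generators_def generator_matrix_def)
  let ?m = "\<lambda>G J. det (submatrix G UNIV J)" and ?M = "map_mat poly_to_fls :: 'a poly mat \<Rightarrow> 'a fls mat"
  let ?\<J> = "{J. J \<subseteq> {..<n} \<and> card J = k}"
  obtain U where U: "U \<in> carrier_mat k k" "U * ?M G1 = ?M G2"
    using conv_code_subset_imp_left_mult[OF G1(2) G2 code] by blast
  obtain J where J: "J \<subseteq> {..<n}" "card J = k" and reg: "red (?m G1 J) \<noteq> 0"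
    using regular_full_minor[OF G1(2,3)] by blast
  have cM: "?M G1 \<in> carrier_mat k n" using G1 by simp
  have dU: "det U * poly_to_fls (?m G1 J') = poly_to_fls (?m G2 J')" if "J' \<in> ?\<J>" for J'
  proof -
    from that have J': "J' \<subseteq> {..<n}" "card J' = k" by auto
    show ?thesis
      using det_submatrix_mult[OF U(1) cM J']
      unfolding U(2) det_submatrix_map[OF poly_to_fls.comm_ring_hom_axioms G1(2) J']
        det_submatrix_map[OF poly_to_fls.comm_ring_hom_axioms G2 J'] by simp
  qed
  define s where "s = ?m G1 J"
  define t where "t = ?m G2 J"
  \<comment> \<open>Eliminating \<open>det U\<close> leaves an identity between polynomials, which
    can be reduced and passed to the gcd.\<close>
  have st: "s * ?m G2 J' = t * ?m G1 J'" if "J' \<in> ?\<J>" for J'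
  proof -
    have "poly_to_fls (s * ?m G2 J') = poly_to_fls (t * ?m G1 J')"
      unfolding s_def t_def poly_to_fls.hom_mult dU[OF that, symmetric] using dU[of J] J
      by (simp add: ac_simps flip: dU[of J])
    then show ?thesis by (simp only: poly_to_fls.eq_iff)
  qed
  have minors: "full_minors (map_mat red G) = (\<lambda>J. red (?m G J)) ` ?\<J>" if "G \<in> carrier_mat k n" for G
    using that det_submatrix_map[OF red.comm_ring_hom_axioms that]
    by (subst full_minors_image[of _ k n]) (auto intro!: image_cong)
  define D1 where "D1 = Gcd (full_minors (map_mat red G1))"
  define D2 where "D2 = Gcd (full_minors (map_mat red G2))"
  have "(*) (red s) ` full_minors (map_mat red G2) = (*) (red t) ` full_minors (map_mat red G1)"
    unfolding minors[OF G1(2)] minors[OF G2] image_image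
    using st by (intro image_cong refl) (simp flip: red.hom_mult)
  then have "normalize (red s * D2) = normalize (red t * D1)"
    unfolding D1_def D2_def by (simp only: Gcd_mult[symmetric])
  then obtain \<epsilon> where \<epsilon>: "is_unit \<epsilon>" "red t * D1 = \<epsilon> * (red s * D2)"
    by (metis associatedE1)
  have "D1 \<noteq> 0" using reg J unfolding D1_def minors[OF G1(2)] by auto
  show ?thesis
  proof (rule ccontr)
    assume ndvd: "\<not> ?thesis"
    \<comment> \<open>Up to the unit \<open>\<epsilon>\<close>, the fraction h0/f0 is the quotient
      of \<open>red t\<close> by \<open>red s\<close> in lowest terms, so \<open>f0\<close> is the
      denominator of the reduced determinant.\<close>
    obtain g f0 h0 where g: "D1 = f0 * g" "D2 = h0 * g" "coprime f0 h0" "g \<noteq> 0"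
      using gcd_coprime_exists[of D1 D2] \<open>D1 \<noteq> 0\<close> by (metis gcd_eq_0_iff)
    have "f0 \<noteq> 0" using g \<open>D1 \<noteq> 0\<close> by auto
    have "\<not> is_unit f0" using ndvd g unfolding D1_def[symmetric] D2_def[symmetric]
      by (metis dvd_refl mult_dvd_mono unit_imp_dvd)
    define f1 where "f1 = smult (inverse (lead_coeff f0)) f0"
    have f1: "monic f1" "degree f1 = degree f0" using \<open>f0 \<noteq> 0\<close> by (auto simp: f1_def)
    have pos: "degree f1 > 0" using f1 \<open>\<not> is_unit f0\<close> \<open>f0 \<noteq> 0\<close> is_unit_iff_degree by auto
    obtain f where f: "red f = f1" "degree f = degree f1" "monic f" using lift_poly[of f1] f1(1) by metis
    interpret residue_split \<rho> \<pi> e f by unfold_locales (use f pos in auto)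
    \<comment> \<open>The constant that makes \<open>f0\<close> monic also scales the numerator,
      which absorbs \<open>\<epsilon>\<close>; thus h1/f1 is still the same fraction.\<close>
    define h1 where "h1 = smult (inverse (lead_coeff f0)) (\<epsilon> * h0)"
    obtain h where h: "red h = h1" using lift_poly by metis
    have "red t * f0 = \<epsilon> * h0 * red s" using \<epsilon>(2) g by (simp add: ac_simps)
    then have q: "red t * red f = red h * red s" unfolding f h f1_def h1_def by simp
    have "coprime (\<epsilon> * h0) f0" using g(3) \<epsilon>(1)
      by (simp add: coprime_commute is_unit_left_imp_coprime)
    moreover have unit: "is_unit [:inverse (lead_coeff f0):]"
      using \<open>f0 \<noteq> 0\<close> by (simp add: is_unit_const_poly_iff dvd_field_iff)
    ultimately have "coprime ([:inverse (lead_coeff f0):] * (\<epsilon> * h0)) ([:inverse (lead_coeff f0):] * f0)"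
      unfolding coprime_mult_left_iff coprime_mult_right_iff
      by (intro conjI is_unit_left_imp_coprime[OF unit] is_unit_right_imp_coprime[OF unit]) auto
    then have "coprime (red h) (red f)" unfolding f h f1_def h1_def by simp
    from exists_smaller_intdeg[OF _ G1(1) G2 U J reg this] q False obtain G' where
      "equivalent_generators k n G1 G'" "intdeg G' < intdeg G1"
      unfolding s_def t_def by blast
    then show False using assms(1) by (auto simp: RIDM_def)
  qed
qed

lemma RIDM_Gcd_eq:
  assumes "RIDM k n G1" "RIDM k n G2" and eq: "equivalent_generators k n G1 G2"
  shows "Gcd (full_minors (map_mat red G1)) = Gcd (full_minors (map_mat red G2))"
proof (rule associated_eqI)
  show "Gcd (full_minors (map_mat red G1)) dvd Gcd (full_minors (map_mat red G2))"
    by (rule RIDM_Gcd_dvd[OF assms(1) eq])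
  show "Gcd (full_minors (map_mat red G2)) dvd Gcd (full_minors (map_mat red G1))"
    by (rule RIDM_Gcd_dvd[OF assms(2)]) (use eq in \<open>auto simp: equivalent_generators_def\<close>)
qed simp_all

end

text \<open>Every element of either ring is the image of an integer, and reduction sends
  \<open>of_int a\<close> to \<open>of_int a\<close> because p divides p^(e+1). The locale axioms
  thus become divisibility statements about integers.\<close>

lemma residue_map_reduce_mod:
  assumes "CARD('p::prime_card) = p" and "CARD('q::nontriv) = p ^ Suc e"
  shows "residue_map (reduce_mod :: 'q mod_ring \<Rightarrow> 'p mod_ring) (of_nat p) e"
proof -
  let ?r = "reduce_mod :: 'q mod_ring \<Rightarrow> 'p mod_ring"
  have dvd: "int CARD('p) dvd int CARD('q)" using assms by simp
  have r: "?r (of_int a) = of_int a" for a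
  proof -
    have "to_int_mod_ring (of_int a :: 'q mod_ring) = a mod int CARD('q)"
      unfolding of_int_of_int_mod_ring by transfer simp
    then have "?r (of_int a) = of_int_mod_ring (a mod int CARD('q))" by (simp add: reduce_mod_def)
    also have "\<dots> = of_int_mod_ring a"
      using dvd by transfer (simp add: mod_mod_cancel)
    finally show ?thesis by (simp add: of_int_of_int_mod_ring)
  qed
  have ex: "\<exists>a. x = of_int a" for x :: "'q mod_ring"
    by (metis of_int_mod_ring_to_int_mod_ring of_int_of_int_mod_ring)
  have ex': "\<exists>a. y = of_int a" for y :: "'p mod_ring"
    by (metis of_int_mod_ring_to_int_mod_ring of_int_of_int_mod_ring)
  have zq: "(of_int a :: 'q mod_ring) = 0 \<longleftrightarrow> int p ^ Suc e dvd a" for a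
  proof -
    have "(of_int a :: 'q mod_ring) = 0 \<longleftrightarrow> int CARD('q) dvd a"
      unfolding of_int_of_int_mod_ring by transfer (simp add: dvd_eq_mod_eq_0)
    then show ?thesis using assms by simp
  qed
  have zp: "(of_int a :: 'p mod_ring) = 0 \<longleftrightarrow> int p dvd a" for a
    unfolding of_int_of_int_mod_ring assms(1)[symmetric] by transfer (simp add: dvd_eq_mod_eq_0)
  have p: "p > 1" using prime_card[where 'a = 'p] assms(1) prime_gt_1_nat by auto
  show ?thesis
  proof
    show "?r 0 = 0" "?r 1 = 1" using r[of 0] r[of 1] by auto
    show "?r (x + y) = ?r x + ?r y" for x y using ex[of x] ex[of y] r by (metis of_int_add)
    show "?r (x * y) = ?r x * ?r y" for x y using ex[of x] ex[of y] r by (metis of_int_mult)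
    show "surj ?r" unfolding surj_def using ex' r by metis
    show "?r x = 0 \<longleftrightarrow> of_nat p dvd x" for x
    proof -
      obtain a where a: "x = of_int a" using ex by blast
      show ?thesis
      proof
        assume "?r x = 0"
        then have "int p dvd a" using a r zp by simp
        then obtain b where "a = int p * b" ..
        then have "x = of_nat p * of_int b" using a by simp
        then show "of_nat p dvd x" by simp
      next
        assume "of_nat p dvd x"
        then obtain y where "x = of_nat p * y" ..
        moreover obtain b where "y = of_int b" using ex by blast
        ultimately have "x = of_int (int p * b)" by simp
        then show "?r x = 0" using r zp by (metis dvd_triv_left)
      qed
    qed
    have "(of_nat p :: 'q mod_ring) ^ e = of_int (int p ^ e)" by simp
    moreover have "\<not> int p ^ Suc e dvd int p ^ e" using p by (simp add: power_dvd_imp_le power_le_dvd)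
    ultimately show "(of_nat p :: 'q mod_ring) ^ e \<noteq> 0" using zq by metis
    have "(of_nat p :: 'q mod_ring) ^ Suc e = of_int (int p ^ Suc e)" by simp
    then show "(of_nat p :: 'q mod_ring) ^ Suc e = 0" using zq by (metis dvd_refl)
  qed
qed

theorem theorem3p1:
  fixes p r k n :: nat
    and G1 G2 :: "'q::nontriv mod_ring poly mat"
  assumes "prime p" and "r \<ge> 1"
    and "CARD('p::prime_card) = p" and "CARD('q) = p ^ r"
    and "RIDM k n G1" and "RIDM k n G2"
    and "equivalent_generators k n G1 G2"
  shows "(residual_structural_poly G1 :: 'p mod_ring poly) = residual_structural_poly G2"
proof -
  obtain e where "r = Suc e" using \<open>r \<ge> 1\<close> by (cases r) auto
  then interpret residue_map "reduce_mod :: 'q mod_ring \<Rightarrow> 'p mod_ring" "of_nat p" e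
    using assms by (intro residue_map_reduce_mod) auto
  show ?thesis
    using RIDM_Gcd_eq[OF assms(5-7)] by (simp add: residual_structural_poly_def reduce_mat_def)
qed

end
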